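(* Let $k_1,k_2\in\mathbb{Z}$ be such that $k_1k_2\ne 0$, and let $m_1,m_2\in\mathbb{R}$ with $m_1\ge -1$ and $m_2\ge -1$. Then the commutator $[T_{e^{ik_1\theta}r^{m_1}},T_{e^{ik_2\theta}r^{m_2}}]$ has finite rank on $L_h^2$ if and only if one of the following conditions holds: (1) $k_1=k_2$ and $m_1=m_2$. (2) $k_1=m_1$ and $k_2=m_2$. (3) $k_1=-m_1$ and $k_2=-m_2$.
   Context: $D$ is the open unit disk in $\mathbb{C}$ and $dA$ is Lebesgue area measure on $D$ normalized so that $D$ has measure $1$. $L_h^2$ is the harmonic Bergman space: the closed subspace of $L^2(D,dA)$ consisting of (complex-valued) harmonic functions. $Q$ is the orthogonal projection of $L^2(D,dA)$ onto $L_h^2$, given by $Qf(z)=\int_D\left(\frac{1}{(1-z\bar w)^2}+\frac{1}{(1-\bar z w)^2}-1\right)f(w)\,dA(w)$; the integral formula extends $Q$ to $L^1(D,dA)$. For $u\in L^1(D,dA)$ the operator $h\mapsto Q(uh)$ is densely defined on the harmonic polynomials in $L_h^2$. $u$ is called a T-function if this operator is bounded in the $L_h^2$ norm; then the Toeplitz operator $T_u:L_h^2\to L_h^2$ is its continuous extension. (Every $u \in L^1(D,dA)$ essentially bounded on some annulus $r_0<|z|<1$ is a T-function; in particular $e^{ik\theta}r^m$ with $k\in\mathbb{Z}$, $m\ge-1$.) Points of $D$ are written $re^{i\theta}$. $[A,B]=AB-BA$. A bounded operator has finite rank if the closure of its range is finite dimensional. *)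

theory Defs
  imports "HOL-Analysis.Analysis"
begin

abbreviation unit_disk :: "complex set" where
  "unit_disk \<equiv> ball 0 1"

definition dA :: "complex measure" where
  "dA = uniform_measure (lebesgue_on unit_disk) unit_disk"

text \<open>Complex-valued harmonic functions on an open set: twice continuously (real)
  differentiable, with vanishing Laplacian. The second derivative at \<open>z\<close> is the bilinear map
  \<open>f'' z\<close>, so that \<open>f'' z 1 1\<close> and \<open>f'' z \<i> \<i>\<close> are the second partial derivatives in \<open>x\<close> and \<open>y\<close>.\<close>

definition harmonic_on :: "complex set \<Rightarrow> (complex \<Rightarrow> complex) \<Rightarrow> bool" where
  "harmonic_on S f \<longleftrightarrow>
     (\<exists>(f' :: complex \<Rightarrow> complex \<Rightarrow>\<^sub>L complex) (f'' :: complex \<Rightarrow> complex \<Rightarrow>\<^sub>L complex \<Rightarrow>\<^sub>L complex).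
        (\<forall>z\<in>S. (f has_derivative blinfun_apply (f' z)) (at z)) \<and>
        (\<forall>z\<in>S. (f' has_derivative blinfun_apply (f'' z)) (at z)) \<and>
        continuous_on S f'' \<and>
        (\<forall>z\<in>S. blinfun_apply (blinfun_apply (f'' z) 1) 1
              + blinfun_apply (blinfun_apply (f'' z) \<i>) \<i> = 0))"

lemma harmonic_on_zero: "harmonic_on S (\<lambda>z. 0)"
  unfolding harmonic_on_def
  by (rule exI[of _ "\<lambda>z. 0"], rule exI[of _ "\<lambda>z. 0"]) (auto simp: zero_blinfun.rep_eq)

lemma harmonic_on_add:
  assumes "harmonic_on S f" "harmonic_on S g"
  shows "harmonic_on S (\<lambda>z. f z + g z)"
proof -
  obtain f' f'' where f:
    "\<And>z. z \<in> S \<Longrightarrow> (f has_derivative blinfun_apply (f' z)) (at z)"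
    "\<And>z. z \<in> S \<Longrightarrow> (f' has_derivative blinfun_apply (f'' z)) (at z)" "continuous_on S f''"
    "\<And>z. z \<in> S \<Longrightarrow> blinfun_apply (blinfun_apply (f'' z) 1) 1
              + blinfun_apply (blinfun_apply (f'' z) \<i>) \<i> = 0"
    using assms(1) unfolding harmonic_on_def by blast
  obtain g' g'' where g:
    "\<And>z. z \<in> S \<Longrightarrow> (g has_derivative blinfun_apply (g' z)) (at z)"
    "\<And>z. z \<in> S \<Longrightarrow> (g' has_derivative blinfun_apply (g'' z)) (at z)" "continuous_on S g''"
    "\<And>z. z \<in> S \<Longrightarrow> blinfun_apply (blinfun_apply (g'' z) 1) 1
              + blinfun_apply (blinfun_apply (g'' z) \<i>) \<i> = 0"
    using assms(2) unfolding harmonic_on_def by blast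
  show ?thesis unfolding harmonic_on_def
  proof (intro exI conjI ballI)
    fix z assume z: "z \<in> S"
    show "((\<lambda>z. f z + g z) has_derivative blinfun_apply (f' z + g' z)) (at z)"
      using has_derivative_add[OF f(1)[OF z] g(1)[OF z]] by (simp add: plus_blinfun.rep_eq)
    show "((\<lambda>z. f' z + g' z) has_derivative blinfun_apply (f'' z + g'' z)) (at z)"
      using has_derivative_add[OF f(2)[OF z] g(2)[OF z]] by (simp add: plus_blinfun.rep_eq)
    show "blinfun_apply (blinfun_apply (f'' z + g'' z) 1) 1
              + blinfun_apply (blinfun_apply (f'' z + g'' z) \<i>) \<i> = 0"
      using f(4)[OF z] g(4)[OF z] by (simp add: plus_blinfun.rep_eq algebra_simps)
  qed (intro continuous_intros f g)
qed

lemma harmonic_on_mult: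
  assumes "harmonic_on S f"
  shows "harmonic_on S (\<lambda>z. c * f z)"
proof -
  obtain f' f'' where f:
    "\<And>z. z \<in> S \<Longrightarrow> (f has_derivative blinfun_apply (f' z)) (at z)"
    "\<And>z. z \<in> S \<Longrightarrow> (f' has_derivative blinfun_apply (f'' z)) (at z)" "continuous_on S f''"
    "\<And>z. z \<in> S \<Longrightarrow> blinfun_apply (blinfun_apply (f'' z) 1) 1
              + blinfun_apply (blinfun_apply (f'' z) \<i>) \<i> = 0"
    using assms(1) unfolding harmonic_on_def by blast
  define M :: "complex \<Rightarrow>\<^sub>L complex" where "M = Blinfun ((*) c)"
  have M: "blinfun_apply M w = c * w" for w
    unfolding M_def by (simp add: bounded_linear_Blinfun_apply bounded_linear_mult_right)
  define L :: "(complex \<Rightarrow>\<^sub>L complex) \<Rightarrow>\<^sub>L (complex \<Rightarrow>\<^sub>L complex)" where "L = Blinfun (\<lambda>g. M o\<^sub>L g)"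
  have bl: "bounded_linear (\<lambda>g. M o\<^sub>L g :: complex \<Rightarrow>\<^sub>L complex)"
    by (rule bounded_bilinear.bounded_linear_right[OF bounded_bilinear_blinfun_compose])
  have L: "blinfun_apply L g = M o\<^sub>L g" for g
    unfolding L_def by (simp add: bounded_linear_Blinfun_apply bl)
  show ?thesis unfolding harmonic_on_def
  proof (intro exI conjI ballI)
    fix z assume z: "z \<in> S"
    show "((\<lambda>z. c * f z) has_derivative blinfun_apply (M o\<^sub>L f' z)) (at z)"
      using has_derivative_mult_right[OF f(1)[OF z], of c]
      by (rule has_derivative_eq_rhs) (simp add: M fun_eq_iff)
    show "((\<lambda>z. M o\<^sub>L f' z) has_derivative blinfun_apply (L o\<^sub>L f'' z)) (at z)"
      using bounded_linear.has_derivative[OF bl f(2)[OF z]]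
      by (rule has_derivative_eq_rhs) (simp add: L fun_eq_iff)
    show "blinfun_apply (blinfun_apply (L o\<^sub>L f'' z) 1) 1
              + blinfun_apply (blinfun_apply (L o\<^sub>L f'' z) \<i>) \<i> = 0"
      using f(4)[OF z] by (simp add: L M flip: distrib_left)
  qed (intro continuous_intros f)
qed

lemma harmonic_on_imp_continuous_on: "harmonic_on S f \<Longrightarrow> continuous_on S f"
  unfolding harmonic_on_def
  by (metis continuous_at_imp_continuous_on has_derivative_continuous)

text \<open>The harmonic Bergman space. Two harmonic functions that agree almost everywhere on the disk
  agree on it, so no quotient is needed; setting the functions to zero outside the disk only makes
  the representing function on the whole plane unique.\<close>

definition harmonic_bergman :: "(complex \<Rightarrow> complex) set" where
  "harmonic_bergman = {f. harmonic_on unit_disk f \<and> integrable dA (\<lambda>z. (norm (f z))\<^sup>2) \<and>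
                          (\<forall>z. z \<notin> unit_disk \<longrightarrow> f z = 0)}"

lemma space_dA [simp]: "space dA = unit_disk"
  by (simp add: dA_def)

lemma sets_dA [simp, measurable_cong]: "sets dA = sets (lebesgue_on unit_disk)"
  by (simp add: dA_def)

lemma emeasure_unit_disk:
  "emeasure (lebesgue_on unit_disk) unit_disk = emeasure lborel unit_disk"
  "emeasure (lebesgue_on unit_disk) unit_disk \<noteq> 0"
  "emeasure (lebesgue_on unit_disk) unit_disk \<noteq> \<infinity>"
proof -
  show 1: "emeasure (lebesgue_on unit_disk) unit_disk = emeasure lborel unit_disk"
    by (simp add: emeasure_restrict_space)
  show "emeasure (lebesgue_on unit_disk) unit_disk \<noteq> 0"
    "emeasure (lebesgue_on unit_disk) unit_disk \<noteq> \<infinity>"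
    unfolding 1 by (simp_all add: emeasure_ball unit_ball_vol_pos order_less_imp_not_eq2)
qed

lemma harmonic_bergmanD:
  assumes "f \<in> harmonic_bergman"
  shows "harmonic_on unit_disk f" "integrable dA (\<lambda>z. (norm (f z))\<^sup>2)"
    "\<And>z. z \<notin> unit_disk \<Longrightarrow> f z = 0" "continuous_on unit_disk f"
    "f \<in> borel_measurable dA"
proof -
  show "harmonic_on unit_disk f" "integrable dA (\<lambda>z. (norm (f z))\<^sup>2)"
    "\<And>z. z \<notin> unit_disk \<Longrightarrow> f z = 0"
    using assms unfolding harmonic_bergman_def by auto
  then show c: "continuous_on unit_disk f"
    by (rule_tac harmonic_on_imp_continuous_on)
  show "f \<in> borel_measurable dA"
    using continuous_imp_measurable_on_sets_lebesgue[OF c]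
    by (simp add: measurable_cong_sets[OF sets_dA refl])
qed

lemma integrable_inner_harmonic_bergman:
  assumes "f \<in> harmonic_bergman" "g \<in> harmonic_bergman"
  shows "integrable dA (\<lambda>z. f z \<bullet> g z)"
proof (rule Bochner_Integration.integrable_bound)
  show "integrable dA (\<lambda>z. (norm (f z))\<^sup>2 + (norm (g z))\<^sup>2)"
    by (intro Bochner_Integration.integrable_add harmonic_bergmanD(2) assms)
  show "(\<lambda>z. f z \<bullet> g z) \<in> borel_measurable dA"
    by (intro borel_measurable_inner harmonic_bergmanD(5) assms)
  show "AE z in dA. norm (f z \<bullet> g z) \<le> norm ((norm (f z))\<^sup>2 + (norm (g z))\<^sup>2)"
  proof (rule AE_I2)
    fix z
    have "norm (f z \<bullet> g z) \<le> norm (f z) * norm (g z)"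
      by (simp add: Cauchy_Schwarz_ineq2)
    also have "\<dots> \<le> (norm (f z))\<^sup>2 + (norm (g z))\<^sup>2"
      using sum_squares_bound[of "norm (f z)" "norm (g z)"]
        mult_nonneg_nonneg[OF norm_ge_zero norm_ge_zero, of "f z" "g z"]
      by linarith
    finally show "norm (f z \<bullet> g z) \<le> norm ((norm (f z))\<^sup>2 + (norm (g z))\<^sup>2)"
      by simp
  qed
qed

lemma harmonic_bergman_zero: "(\<lambda>z. 0) \<in> harmonic_bergman"
  by (simp add: harmonic_bergman_def harmonic_on_zero)

lemma harmonic_bergman_add:
  assumes "f \<in> harmonic_bergman" "g \<in> harmonic_bergman"
  shows "(\<lambda>z. f z + g z) \<in> harmonic_bergman"
proof -
  have eq: "(norm (f z + g z))\<^sup>2 = (norm (f z))\<^sup>2 + (norm (g z))\<^sup>2 + 2 * (f z \<bullet> g z)" for z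
    by (simp add: power2_norm_eq_inner inner_add_left inner_add_right inner_commute)
  have "integrable dA (\<lambda>z. (norm (f z + g z))\<^sup>2)"
    unfolding eq
    by (intro Bochner_Integration.integrable_add integrable_mult_right harmonic_bergmanD(2)
        integrable_inner_harmonic_bergman assms)
  then show ?thesis
    using assms unfolding harmonic_bergman_def by (simp add: harmonic_on_add)
qed

lemma harmonic_bergman_mult:
  assumes "f \<in> harmonic_bergman"
  shows "(\<lambda>z. c * f z) \<in> harmonic_bergman"
  using assms by (auto simp: harmonic_bergman_def harmonic_on_mult norm_mult power_mult_distrib)

typedef lh2 = harmonic_bergman
  morphisms lh2_fun Abs_lh2
  using harmonic_bergman_zero by blast

setup_lifting type_definition_lh2

lift_definition scaleC_lh2 :: "complex \<Rightarrow> lh2 \<Rightarrow> lh2" is "\<lambda>c f z. c * f z"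
  by (rule harmonic_bergman_mult)

text \<open>On a space of complex-valued functions \<open>inner\<close> is the real part of the \<open>L\<^sup>2\<close> scalar product;
  it induces the \<open>L\<^sup>2\<close> norm.\<close>

instantiation lh2 :: real_inner
begin

lift_definition zero_lh2 :: lh2 is "\<lambda>z. 0" by (rule harmonic_bergman_zero)
lift_definition plus_lh2 :: "lh2 \<Rightarrow> lh2 \<Rightarrow> lh2" is "\<lambda>f g z. f z + g z"
  by (rule harmonic_bergman_add)
lift_definition uminus_lh2 :: "lh2 \<Rightarrow> lh2" is "\<lambda>f z. - f z"
  using harmonic_bergman_mult[of _ "-1"] by simp
lift_definition minus_lh2 :: "lh2 \<Rightarrow> lh2 \<Rightarrow> lh2" is "\<lambda>f g z. f z - g z"
  using harmonic_bergman_add[OF _ harmonic_bergman_mult[of _ "-1"]] by simp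
lift_definition scaleR_lh2 :: "real \<Rightarrow> lh2 \<Rightarrow> lh2" is "\<lambda>r f z. r *\<^sub>R f z"
  unfolding scaleR_conv_of_real by (rule harmonic_bergman_mult)
lift_definition inner_lh2 :: "lh2 \<Rightarrow> lh2 \<Rightarrow> real" is "\<lambda>f g. LINT z|dA. f z \<bullet> g z" .

definition norm_lh2 :: "lh2 \<Rightarrow> real" where "norm_lh2 f = sqrt (inner f f)"
definition sgn_lh2 :: "lh2 \<Rightarrow> lh2" where "sgn_lh2 f = inverse (norm f) *\<^sub>R f"
definition dist_lh2 :: "lh2 \<Rightarrow> lh2 \<Rightarrow> real" where "dist_lh2 f g = norm (f - g)"
definition uniformity_lh2 :: "(lh2 \<times> lh2) filter" where
  "uniformity_lh2 = (INF e\<in>{0<..}. principal {(x, y). dist x y < e})"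
definition open_lh2 :: "lh2 set \<Rightarrow> bool" where
  "open_lh2 U = (\<forall>x\<in>U. \<forall>\<^sub>F (x', y) in uniformity. x' = x \<longrightarrow> y \<in> U)"

instance
proof
  fix f g h :: lh2 and r s :: real
  show "f + g + h = f + (g + h)" "f + g = g + f" "0 + f = f" "- f + f = 0" "f - g = f + - g"
    by (transfer; simp add: algebra_simps)+
  show "r *\<^sub>R (f + g) = r *\<^sub>R f + r *\<^sub>R g" "(r + s) *\<^sub>R f = r *\<^sub>R f + s *\<^sub>R f"
    "r *\<^sub>R s *\<^sub>R f = (r * s) *\<^sub>R f" "1 *\<^sub>R f = f"
    by (transfer; simp add: algebra_simps)+
  show "dist f g = norm (f - g)" "sgn f = inverse (norm f) *\<^sub>R f"
    by (simp_all add: dist_lh2_def sgn_lh2_def)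
  show "uniformity = (INF e\<in>{0<..}. principal {(x, y :: lh2). dist x y < e})"
    by (simp add: uniformity_lh2_def)
  show "open U = (\<forall>x\<in>U. \<forall>\<^sub>F (x', y) in uniformity. x' = x \<longrightarrow> y \<in> U)" for U :: "lh2 set"
    by (simp add: open_lh2_def)
  show "norm f = sqrt (inner f f)"
    by (simp add: norm_lh2_def)
  show "inner f g = inner g f"
    by transfer (simp add: inner_commute)
  show "inner (f + g) h = inner f h + inner g h"
    by transfer
      (simp add: inner_add_left Bochner_Integration.integral_add integrable_inner_harmonic_bergman)
  show "inner (r *\<^sub>R f) g = r * inner f g"
    by transfer simp
  show "0 \<le> inner f f"
    by transfer simp
  show "inner f f = 0 \<longleftrightarrow> f = 0"
  proof
    assume "inner f f = 0"
    then show "f = 0"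
    proof transfer
      fix f assume f: "f \<in> harmonic_bergman" and 0: "(LINT z|dA. f z \<bullet> f z) = 0"
      have "AE z in dA. f z \<bullet> f z = 0"
        using 0 integrable_inner_harmonic_bergman[OF f f] by (simp add: integral_nonneg_eq_0_iff_AE)
      then have "AE z in dA. f z = 0"
        by simp
      then have "AE z in lebesgue_on unit_disk. z \<in> unit_disk \<longrightarrow> f z = 0"
        unfolding dA_def
        by (subst (asm) AE_uniform_measure) (use emeasure_unit_disk in \<open>auto simp: less_top\<close>)
      then have "AE z in lebesgue. z \<in> unit_disk \<longrightarrow> f z = 0"
        by (subst (asm) AE_restrict_space_iff) auto
      then obtain N where N: "N \<in> null_sets lebesgue"
        "\<And>z. z \<notin> N \<Longrightarrow> z \<in> unit_disk \<Longrightarrow> f z = 0"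
        by (rule AE_E3) auto
      have "f z = 0" if z: "z \<in> unit_disk" for z
      proof (rule ccontr)
        assume nz: "f z \<noteq> 0"
        have op: "open (unit_disk \<inter> f -` (- {0}))"
          using harmonic_bergmanD(4)[OF f]
          by (intro continuous_open_preimage) auto
        have "negligible (unit_disk \<inter> f -` (- {0}))"
          by (rule negligible_subset[of N])
            (use N in \<open>auto simp: negligible_iff_null_sets simp del: mem_ball\<close>)
        then show False
          using open_not_negligible[OF op] z nz by blast
      qed
      then show "f = (\<lambda>z. 0)"
        using harmonic_bergmanD(3)[OF f] by blast
    qed
  next
    assume "f = 0"
    then show "inner f f = 0" by transfer simp
  qed
qed

end

interpretation lh2: vector_space scaleC_lh2
  by unfold_locales (transfer; simp add: algebra_simps)+

text \<open>The kernel formula for the orthogonal projection, for \<open>z\<close> in the disk.\<close>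

definition Q :: "(complex \<Rightarrow> complex) \<Rightarrow> complex \<Rightarrow> complex" where
  "Q f z = (LINT w|dA. (1 / (1 - z * cnj w)\<^sup>2 + 1 / (1 - cnj z * w)\<^sup>2 - 1) * f w)"

text \<open>Polynomials in \<open>x\<close> and \<open>y\<close> are the same as polynomials in \<open>z\<close> and \<open>cnj z\<close>;
  harmonicity is part of membership in the type \<open>lh2\<close>.\<close>

definition harmonic_polynomials :: "lh2 set" where
  "harmonic_polynomials =
     {h. \<exists>(n::nat) (a :: nat \<Rightarrow> nat \<Rightarrow> complex).
           \<forall>z\<in>unit_disk. lh2_fun h z = (\<Sum>i\<le>n. \<Sum>j\<le>n. a i j * z ^ i * cnj z ^ j)}"

text \<open>The densely defined operator \<open>h \<mapsto> Q (u h)\<close>, defined on the harmonic polynomials, has a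
  bounded extension to \<open>lh2\<close> iff it is bounded there, i.e. iff \<open>u\<close> is a T-function; the extension
  is then unique. For other \<open>u\<close> the value of \<open>toeplitz u\<close> is meaningless.\<close>

definition T_function :: "(complex \<Rightarrow> complex) \<Rightarrow> bool" where
  "T_function u \<longleftrightarrow> integrable dA u \<and>
     (\<exists>C. \<forall>h\<in>harmonic_polynomials. \<exists>g::lh2.
        (\<forall>z\<in>unit_disk. lh2_fun g z = Q (\<lambda>w. u w * lh2_fun h w) z) \<and> norm g \<le> C * norm h)"

definition toeplitz :: "(complex \<Rightarrow> complex) \<Rightarrow> lh2 \<Rightarrow>\<^sub>L lh2" where
  "toeplitz u = (THE T. \<forall>h\<in>harmonic_polynomials. \<forall>z\<in>unit_disk.
     lh2_fun (blinfun_apply T h) z = Q (\<lambda>w. u w * lh2_fun h w) z)"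

definition commutator :: "(lh2 \<Rightarrow>\<^sub>L lh2) \<Rightarrow> (lh2 \<Rightarrow>\<^sub>L lh2) \<Rightarrow> (lh2 \<Rightarrow>\<^sub>L lh2)" where
  "commutator A B = (A o\<^sub>L B) - (B o\<^sub>L A)"

text \<open>Finite-dimensional over the complex numbers: \<open>lh2.span\<close> is the span with respect to
  \<open>scaleC_lh2\<close>.\<close>

definition finite_rank :: "(lh2 \<Rightarrow>\<^sub>L lh2) \<Rightarrow> bool" where
  "finite_rank T \<longleftrightarrow> (\<exists>B. finite B \<and> closure (range (blinfun_apply T)) \<subseteq> lh2.span B)"

text \<open>The function \<open>e\<^sup>i\<^sup>k\<^sup>\<theta> r\<^sup>m\<close>; its value at the origin is irrelevant.\<close>

definition quasihomogeneous :: "int \<Rightarrow> real \<Rightarrow> complex \<Rightarrow> complex" where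
  "quasihomogeneous k m z = cis (of_int k * Arg z) * of_real (norm z powr m)"

end

theory Submission
  imports Defs "HOL-Complex_Analysis.Cauchy_Integral_Formula"
begin

text \<open>The harmonic monomials \<open>e\<^sub>n\<close>, namely \<open>z\<^sup>n\<close> for \<open>n \<ge> 0\<close> and the
\<open>\<bar>n\<bar>\<close>-th power of the conjugate for \<open>n < 0\<close>, form an orthogonal basis of the harmonic Bergman
space, and the Toeplitz operator with symbol \<open>e\<^sup>i\<^sup>k\<^sup>\<theta> r\<^sup>m\<close> sends \<open>e\<^sub>n\<close> to the multiple
\<open>2 (\<bar>n + k\<bar> + 1) / (m + \<bar>n\<bar> + \<bar>n + k\<bar> + 2)\<close> of \<open>e\<^sub>n\<^sub>+\<^sub>k\<close>
(\<open>lh2_coeff_toeplitz_quasihomogeneous\<close>). The commutator is therefore a weighted shift by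
\<open>k1 + k2\<close>, and a weighted shift has finite rank precisely when only finitely many of its weights
are nonzero (\<open>finite_rank_weighted_shift_iff\<close>).

For \<open>n \<ge> \<bar>k1\<bar> + \<bar>k2\<bar>\<close> the absolute values in the weights can be dropped, and the weight of the
commutator is a quotient of polynomials in \<open>n\<close>. In the numerator the cubic and quadratic terms
cancel (\<open>commutator_weight_eq_0_iff\<close>), so it vanishes for all large \<open>n\<close> as soon as it vanishes
twice, that is, when the remaining linear polynomial is zero. Its leading coefficient forces
\<open>(m1, m2) = t (k1, k2)\<close>, and its constant term then equals
\<open>k1 k2 (k2 - k1) (t\<^sup>2 - 1)\<close>; hence \<open>k1 = k2\<close> or \<open>t = 1\<close> or \<open>t = -1\<close>, which are the three
conditions. The substitution of \<open>-n\<close> for \<open>n\<close> changes the signs of \<open>k1\<close> and \<open>k2\<close>; it fixes the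
first condition and exchanges the other two, so the weights at \<open>-\<infinity>\<close> give nothing new.

The analytic work lies in the basis. A harmonic function on the disk is the sum of a holomorphic
and an antiholomorphic function, so it is a series \<open>\<Sum> a\<^sub>n e\<^sub>n\<close>; by orthogonality on concentric
disks its squared norm is the supremum of the sums of \<open>\<bar>a\<^sub>n\<bar>\<^sup>2 / (\<bar>n\<bar> + 1)\<close> over
\<open>\<bar>n\<bar> \<le> N\<close> (\<open>energy_le_integral\<close>, \<open>integral_le_of_energy_le\<close>). This identification with a
weighted sequence space makes all shifts with bounded weights bounded operators
(\<open>ex_weighted_shift\<close>) and the harmonic polynomials dense (\<open>lh2_partial_sum_tendsto\<close>). Together
with the value of \<open>Q\<close> on quasihomogeneous functions it identifies \<open>toeplitz\<close> with such a shift.\<close>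

section \<open>Rotation invariance and the radial law of the area measure\<close>

text \<open>The usual uniqueness argument for Haar measure. Let \<open>N\<close> be the image measure and \<open>B\<close> the unit
ball. Both \<open>N\<close> and Lebesgue measure are invariant under translations, and they agree on every
translate of \<open>B\<close>. Evaluating the integral of \<open>1\<^sub>A(x) 1\<^sub>B(x - y)\<close> in both orders over the
product of the two measures gives \<open>\<lambda>(A) \<lambda>(B) = N(A) \<lambda>(B)\<close>.\<close>

lemma lborel_distr_orthogonal:
  fixes f :: "'a::euclidean_space \<Rightarrow> 'a"
  assumes f: "orthogonal_transformation f"
  shows "distr lborel borel f = lborel"
proof -
  have lin: "linear f" and nrm: "norm (f x) = norm x" for x
    using f by (auto simp: orthogonal_transformation)
  have contf: "continuous_on UNIV f"
    using lin by (simp add: linear_continuous_on linear_conv_bounded_linear)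
  have mf [measurable]: "f \<in> borel_measurable borel"
    by (rule borel_measurable_continuous_onI[OF contf])
  have surj: "surj f" using f by (rule orthogonal_transformation_surj)
  define N where "N = distr lborel borel f"
  have sN [measurable_cong]: "sets N = sets borel" and spN: "space N = UNIV"
    by (auto simp: N_def)
  have eN: "emeasure N A = emeasure lborel (f -` A)" if "A \<in> sets borel" for A
    using that by (simp add: N_def emeasure_distr)
  have translate: "emeasure lborel ((\<lambda>x. t + x) -` A) = emeasure lborel A" if "A \<in> sets borel" for A and t :: 'a
  proof -
    have "emeasure lborel A = emeasure (distr lborel borel ((+) t)) A"
      by (simp add: lborel_distr_plus)
    also have "\<dots> = emeasure lborel ((\<lambda>x. t + x) -` A)"
      using that by (subst emeasure_distr) auto
    finally show ?thesis by simp
  qed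
  have translateN: "emeasure N ((\<lambda>x. t + x) -` A) = emeasure N A" if A: "A \<in> sets borel" for A and t :: 'a
  proof -
    obtain s where s: "t = f s" using surj by blast
    have B: "f -` A \<in> sets borel" using measurable_sets[OF mf A] by simp
    have C: "(\<lambda>x. t + x) -` A \<in> sets borel" using A
      using measurable_sets[of "(+) t" borel borel A] by simp
    have "emeasure N ((\<lambda>x. t + x) -` A) = emeasure lborel ((\<lambda>x. s + x) -` (f -` A))"
      unfolding eN[OF C] by (rule arg_cong[where f="emeasure lborel"])
        (auto simp: s linear_add[OF lin])
    also have "\<dots> = emeasure N A"
      unfolding eN[OF A] by (rule translate[OF B])
    finally show ?thesis .
  qed
  have ballN: "emeasure N (ball x 1) = emeasure lborel (ball (0::'a) 1)" for x
  proof -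
    have "emeasure N (ball x 1) = emeasure N ((\<lambda>y. x + y) -` ball x 1)"
      by (rule translateN[symmetric]) simp
    also have "(\<lambda>y. x + y) -` ball x 1 = ball 0 1"
      by (auto simp: dist_norm)
    also have "emeasure N (ball 0 1) = emeasure lborel (f -` ball 0 1)"
      by (simp add: eN)
    also have "f -` ball 0 1 = ball 0 1"
      by (auto simp: nrm)
    finally show ?thesis .
  qed
  interpret N: sigma_finite_measure N
  proof
    show "\<exists>A. countable A \<and> A \<subseteq> sets N \<and> \<Union> A = space N \<and> (\<forall>a\<in>A. emeasure N a \<noteq> \<infinity>)"
    proof (intro exI conjI)
      show "countable (range (\<lambda>n::nat. ball (0::'a) (real n)))" by simp
      show "range (\<lambda>n::nat. ball (0::'a) (real n)) \<subseteq> sets N" by (auto simp: sN)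
      show "\<Union> (range (\<lambda>n::nat. ball (0::'a) (real n))) = space N"
        by (auto simp: spN intro: reals_Archimedean2)
      have *: "f -` ball 0 r = ball 0 r" for r by (auto simp: nrm)
      show "\<forall>a\<in>range (\<lambda>n::nat. ball (0::'a) (real n)). emeasure N a \<noteq> \<infinity>"
        by (auto simp: eN * emeasure_ball)
    qed
  qed
  interpret P: pair_sigma_finite lborel N ..
  let ?B = "ball (0::'a) 1" and ?b = "emeasure lborel (ball (0::'a) 1)"
  have b: "?b \<noteq> 0" "?b \<noteq> \<infinity>"
    by (simp_all add: emeasure_ball unit_ball_vol_pos order_less_imp_not_eq2)
  have "emeasure N A = emeasure lborel A" if A [measurable]: "A \<in> sets borel" for A
  proof -
    let ?F = "\<lambda>x y. indicator A x * indicator ?B (x - y) :: ennreal"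
    let ?G = "\<lambda>t y. indicator A (y + t) * indicator ?B t :: ennreal"
    have [measurable]: "Measurable.pred (borel \<Otimes>\<^sub>M borel) (\<lambda>p::'a \<times> 'a. fst p - snd p \<in> ?B)"
      by (simp only: mem_ball dist_0_norm) measurable
    have swap: "(\<integral>\<^sup>+y. (\<integral>\<^sup>+x. ?F x y \<partial>lborel) \<partial>N) = (\<integral>\<^sup>+x. (\<integral>\<^sup>+y. ?F x y \<partial>N) \<partial>lborel)"
      by (rule P.Fubini') measurable
    have [measurable]: "Measurable.pred (borel \<Otimes>\<^sub>M borel) (\<lambda>p::'a \<times> 'a. fst p \<in> ?B)"
      by (simp only: mem_ball dist_0_norm) measurable
    have swap': "(\<integral>\<^sup>+y. (\<integral>\<^sup>+t. ?G t y \<partial>lborel) \<partial>N) = (\<integral>\<^sup>+t. (\<integral>\<^sup>+y. ?G t y \<partial>N) \<partial>lborel)"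
      by (rule P.Fubini') measurable
    have "emeasure lborel A * ?b = (\<integral>\<^sup>+x. indicator A x * ?b \<partial>lborel)"
      by (simp add: nn_integral_multc)
    also have "\<dots> = (\<integral>\<^sup>+x. (\<integral>\<^sup>+y. ?F x y \<partial>N) \<partial>lborel)"
    proof (rule nn_integral_cong)
      fix x :: 'a
      have "(\<integral>\<^sup>+y. ?F x y \<partial>N) = indicator A x * (\<integral>\<^sup>+y. indicator (ball x 1) y \<partial>N)"
        by (subst nn_integral_cmult[symmetric])
          (auto intro!: nn_integral_cong borel_measurable_indicator simp: sN indicator_def dist_norm norm_minus_commute)
      then show "indicator A x * ?b = (\<integral>\<^sup>+y. ?F x y \<partial>N)"
        by (simp add: nn_integral_indicator sN ballN)
    qed
    also have "\<dots> = (\<integral>\<^sup>+y. (\<integral>\<^sup>+x. ?F x y \<partial>lborel) \<partial>N)"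
      by (rule swap[symmetric])
    also have "\<dots> = (\<integral>\<^sup>+y. (\<integral>\<^sup>+t. ?G t y \<partial>lborel) \<partial>N)"
    proof (rule nn_integral_cong)
      fix y :: 'a
      have "(\<integral>\<^sup>+x. ?F x y \<partial>lborel) = (\<integral>\<^sup>+x. ?F x y \<partial>distr lborel borel ((+) y))"
        by (simp add: lborel_distr_plus)
      also have "\<dots> = (\<integral>\<^sup>+t. ?G t y \<partial>lborel)"
      proof -
        have [measurable]: "Measurable.pred borel (\<lambda>x. x - y \<in> ?B)"
          by (simp only: mem_ball dist_0_norm) measurable
        have "(\<lambda>x. ?F x y) \<in> borel_measurable borel" by measurable
        then show ?thesis
          using nn_integral_distr[of "(+) y" lborel borel "\<lambda>x. ?F x y"] by simp
      qed
      finally show "(\<integral>\<^sup>+x. ?F x y \<partial>lborel) = (\<integral>\<^sup>+t. ?G t y \<partial>lborel)" .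
    qed
    also have "\<dots> = (\<integral>\<^sup>+t. (\<integral>\<^sup>+y. ?G t y \<partial>N) \<partial>lborel)"
      by (rule swap')
    also have "\<dots> = (\<integral>\<^sup>+t. emeasure N A * indicator ?B t \<partial>lborel)"
    proof (rule nn_integral_cong)
      fix t :: 'a
      have C: "(\<lambda>x. t + x) -` A \<in> sets borel" using A
        using measurable_sets[of "(+) t" borel borel A] by simp
      have "(\<integral>\<^sup>+y. ?G t y \<partial>N) = (\<integral>\<^sup>+y. indicator ((\<lambda>x. t + x) -` A) y * indicator ?B t \<partial>N)"
        by (auto intro!: nn_integral_cong simp: indicator_def add.commute)
      also have "\<dots> = emeasure N ((\<lambda>x. t + x) -` A) * indicator ?B t"
        using C by (simp add: nn_integral_multc nn_integral_indicator sN)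
      finally show "(\<integral>\<^sup>+y. ?G t y \<partial>N) = emeasure N A * indicator ?B t"
        by (simp add: translateN A)
    qed
    also have "\<dots> = emeasure N A * ?b"
      by (subst nn_integral_cmult_indicator) auto
    finally have "emeasure lborel A * ?b / ?b = emeasure N A * ?b / ?b"
      by simp
    then show ?thesis
      using b by (simp add: mult_divide_eq_ennreal)
  qed
  then show ?thesis unfolding N_def[symmetric]
    by (intro measure_eqI) (auto simp: sN)
qed

lemma borel_measurable_dA:
  assumes "f \<in> borel_measurable borel"
  shows "f \<in> borel_measurable dA"
proof -
  have "f \<in> borel_measurable (lebesgue_on unit_disk)"
    using assms by (intro measurable_restrict_space1 measurable_completion) simp
  then show ?thesis by (simp add: measurable_cong_sets[OF sets_dA refl])
qed

lemma emeasure_dA: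
  assumes "A \<in> sets borel"
  shows "emeasure dA (A \<inter> unit_disk) = emeasure lborel (A \<inter> unit_disk) / ennreal pi"
proof -
  have "emeasure (lebesgue_on unit_disk) (A \<inter> unit_disk) = emeasure lborel (A \<inter> unit_disk)"
    using assms by (subst emeasure_restrict_space) auto
  moreover have "emeasure lborel unit_disk = ennreal pi"
    by (simp add: emeasure_ball unit_ball_vol_2)
  moreover have "A \<inter> unit_disk \<in> sets (lebesgue_on unit_disk)"
    using assms by (subst sets_restrict_space_iff) auto
  ultimately show ?thesis
    unfolding dA_def using emeasure_unit_disk(1)
    by (subst emeasure_uniform_measure) (auto simp: Int_absorb1 Int_commute)
qed

lemma emeasure_distr_dA:
  assumes "g \<in> borel_measurable borel" "A \<in> sets borel"
  shows "emeasure (distr dA borel g) A = emeasure lborel (g -` A \<inter> unit_disk) / ennreal pi"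
proof -
  have "g -` A \<in> sets borel"
    using measurable_sets[OF assms] by simp
  then show ?thesis
    using assms by (simp add: emeasure_distr borel_measurable_dA emeasure_dA)
qed

lemma distr_dA_rotation:
  assumes "norm c = 1"
  shows "distr dA borel (\<lambda>z. c * z) = distr dA borel (\<lambda>z. z)"
proof (rule measure_eqI)
  fix A assume "A \<in> sets (distr dA borel (\<lambda>z. c * z))"
  then have A: "A \<in> sets borel" by simp
  have "orthogonal_transformation (\<lambda>z. c * z)"
    using assms by (auto simp: orthogonal_transformation norm_mult bounded_linear.linear[OF bounded_linear_mult_right])
  then have *: "distr lborel borel (\<lambda>z. c * z) = lborel"
    by (rule lborel_distr_orthogonal)
  have "emeasure lborel (A \<inter> unit_disk) = emeasure (distr lborel borel (\<lambda>z. c * z)) (A \<inter> unit_disk)"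
    by (simp add: *)
  also have "\<dots> = emeasure lborel ((\<lambda>z. c * z) -` A \<inter> unit_disk)"
    using assms A by (subst emeasure_distr) (auto intro!: arg_cong[where f="emeasure lborel"] simp: norm_mult)
  finally show "emeasure (distr dA borel (\<lambda>z. c * z)) A = emeasure (distr dA borel (\<lambda>z. z)) A"
    using A by (simp add: emeasure_distr_dA)
qed simp

text \<open>The disk of radius \<open>\<surd>x\<close> has normalized area \<open>x\<close>, so the squared radius is uniformly distributed
on the unit interval. This reduces radial integrals to integrals of powers.\<close>

lemma distr_dA_square_radius:
  "distr dA borel (\<lambda>z. (norm z)\<^sup>2) = density lborel (indicator {0..1::real})"
proof (rule measure_eqI_lessThan)
  have dens: "emeasure (density lborel (indicator {0..1::real})) {x<..} = emeasure lborel ({x<..} \<inter> {0..1})" for x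
    by (subst emeasure_density)
      (auto simp: nn_integral_indicator[symmetric] indicator_def intro!: nn_integral_cong)
  have m: "(\<lambda>z::complex. (norm z)\<^sup>2) \<in> borel_measurable borel" by measurable
  have pi: "ennreal pi \<noteq> 0" "ennreal pi \<noteq> top" by auto
  fix x :: real
  show eq: "emeasure (distr dA borel (\<lambda>z. (norm z)\<^sup>2)) {x<..} = emeasure (density lborel (indicator {0..1})) {x<..}"
  proof -
    let ?S = "(\<lambda>z::complex. (norm z)\<^sup>2) -` {x<..} \<inter> unit_disk"
    consider "x < 0" | "0 \<le> x" "x < 1" | "1 \<le> x" by linarith
    then show ?thesis
    proof cases
      case 1
      have "x < (norm z)\<^sup>2" for z :: complex
        using 1 zero_le_power2[of "norm z"] by linarith
      then have "?S = unit_disk" by auto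
      moreover have "{x<..} \<inter> {0..1} = {0..1}" using 1 by auto
      ultimately show ?thesis
        using pi by (simp add: emeasure_distr_dA[OF m] dens emeasure_ball unit_ball_vol_2)
    next
      case 2
      have "x < (norm z)\<^sup>2 \<longleftrightarrow> sqrt x < norm z" for z :: complex
        by (metis norm_ge_zero real_sqrt_less_iff real_sqrt_abs abs_of_nonneg)
      then have "?S = unit_disk - cball 0 (sqrt x)" by auto
      moreover have "cball (0::complex) (sqrt x) \<subseteq> unit_disk"
        using 2 by (subst cball_subset_ball_iff) simp
      ultimately have "emeasure lborel ?S = emeasure lborel unit_disk - emeasure lborel (cball (0::complex) (sqrt x))"
        using 2 by (simp add: emeasure_Diff emeasure_cball)
      also have "\<dots> = ennreal (pi * (1 - x))"
        using 2 by (simp add: emeasure_ball emeasure_cball unit_ball_vol_2 ennreal_minus algebra_simps)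
      finally have "emeasure (distr dA borel (\<lambda>z. (norm z)\<^sup>2)) {x<..} = ennreal (1 - x)"
        using 2 by (simp add: emeasure_distr_dA[OF m] divide_ennreal)
      moreover have "{x<..} \<inter> {0..1} = {x<..1}" using 2 by auto
      ultimately show ?thesis using 2 by (simp add: dens)
    next
      case 3
      have "(norm z)\<^sup>2 < x" if "norm z < 1" for z :: complex
        using that 3 power_less_one_iff[of "norm z" 2] by auto
      then have "?S = {}" by force
      moreover have "{x<..} \<inter> {0..1} = {}" using 3 by auto
      ultimately show ?thesis
        by (simp add: emeasure_distr_dA[OF m] dens)
    qed
  qed
  have "emeasure lborel ({x<..} \<inter> {0..1}) \<le> emeasure lborel {0..1::real}"
    by (intro emeasure_mono) auto
  then show "emeasure (distr dA borel (\<lambda>z. (norm z)\<^sup>2)) {x<..} < \<infinity>"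
    unfolding eq dens by (simp add: le_less_trans)
qed simp_all

section \<open>Integrals of quasihomogeneous functions\<close>

definition harmonic_monomial :: "int \<Rightarrow> complex \<Rightarrow> complex" where
  "harmonic_monomial n z = (if n \<ge> 0 then z ^ nat n else cnj z ^ nat (- n))"

lemma harmonic_monomial_unit:
  assumes "norm u = 1"
  shows "harmonic_monomial n u = u powi n"
proof -
  have "inverse u = cnj u"
    using assms by (simp add: divide_conv_cnj inverse_eq_divide)
  then show ?thesis by (simp add: harmonic_monomial_def power_int_def)
qed

lemma harmonic_monomial_polar:
  "harmonic_monomial n z = harmonic_monomial n (sgn z) * of_real (norm z ^ nat \<bar>n\<bar>)"
proof -
  have z: "z = sgn z * of_real (norm z)"
    by (simp add: sgn_eq)
  have c: "cnj z = cnj (sgn z) * of_real (norm z)"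
    by (subst z) simp
  show ?thesis
  proof (cases "n \<ge> 0")
    case True
    have "z ^ nat n = sgn z ^ nat n * of_real (norm z ^ nat n)"
      by (subst z) (simp add: power_mult_distrib)
    then show ?thesis using True by (simp add: harmonic_monomial_def)
  next
    case False
    have "cnj z ^ nat (-n) = cnj (sgn z) ^ nat (-n) * of_real (norm z ^ nat (-n))"
      by (subst c) (simp add: power_mult_distrib)
    then show ?thesis using False by (simp add: harmonic_monomial_def)
  qed
qed

lemma norm_harmonic_monomial: "norm (harmonic_monomial n z) = norm z ^ nat \<bar>n\<bar>"
  by (simp add: harmonic_monomial_def norm_power)

lemma continuous_on_harmonic_monomial: "continuous_on S (harmonic_monomial n)"
  unfolding harmonic_monomial_def by (cases "n \<ge> 0") (auto intro!: continuous_intros)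

text \<open>This form is manifestly Borel measurable and gives the behaviour under rotations, neither of which
is visible from the argument function with its jump.\<close>

lemma quasihomogeneous_altdef:
  "quasihomogeneous k s z = harmonic_monomial k (sgn z) * of_real (norm z powr s)"
proof (cases "z = 0")
  case False
  have "cis (Arg z) = sgn z" using False by (rule cis_Arg)
  then have "cis (of_int k * Arg z) = sgn z powi k"
    by (metis cis_power_int)
  moreover have "norm (sgn z) = 1" using False by (simp add: norm_sgn)
  ultimately show ?thesis
    by (simp only: quasihomogeneous_def harmonic_monomial_unit)
qed (simp add: quasihomogeneous_def)

lemma quasihomogeneous_0 [simp]: "quasihomogeneous k s 0 = 0"
  by (simp add: quasihomogeneous_def)

lemma norm_quasihomogeneous: "norm (quasihomogeneous k s z) = norm z powr s"
  by (simp add: quasihomogeneous_def norm_mult)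

lemma borel_measurable_quasihomogeneous [measurable]:
  "quasihomogeneous k s \<in> borel_measurable borel"
proof -
  have "(\<lambda>z. harmonic_monomial k (sgn z)) \<in> borel_measurable borel"
    unfolding sgn_div_norm
    by (rule measurable_compose[OF _ borel_measurable_continuous_onI[OF continuous_on_harmonic_monomial]])
      measurable
  moreover have "quasihomogeneous k s = (\<lambda>z. harmonic_monomial k (sgn z) * of_real (norm z powr s))"
    by (simp add: fun_eq_iff quasihomogeneous_altdef)
  ultimately show ?thesis by simp
qed

lemma quasihomogeneous_mult:
  "quasihomogeneous k s z * quasihomogeneous l t z = quasihomogeneous (k + l) (s + t) z"
proof (cases "z = 0")
  case False
  then show ?thesis
    by (simp add: quasihomogeneous_def cis_mult powr_add algebra_simps)
qed simp

text \<open>The origin has to be excluded only for \<open>n = 0\<close>: there the left-hand side is \<open>0\<close>, since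
\<open>0 powr 0 = 0\<close>, but the monomial is \<open>1\<close>.\<close>

lemma quasihomogeneous_eq_harmonic_monomial:
  assumes "z \<noteq> 0"
  shows "quasihomogeneous n (real_of_int \<bar>n\<bar>) z = harmonic_monomial n z"
proof -
  have "norm z powr real_of_int \<bar>n\<bar> = norm z ^ nat \<bar>n\<bar>"
    using assms powr_realpow[of "norm z" "nat \<bar>n\<bar>"] by simp
  then show ?thesis
    by (metis quasihomogeneous_altdef harmonic_monomial_polar)
qed

lemma quasihomogeneous_rotate:
  assumes "norm c = 1"
  shows "quasihomogeneous k s (c * z) = c powi k * quasihomogeneous k s z"
proof (cases "z = 0")
  case False
  have c: "sgn c = c" using assms by (simp add: sgn_div_norm)
  have "norm (sgn z) = 1" using False by (simp add: norm_sgn)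
  then show ?thesis
    using assms
    by (simp add: quasihomogeneous_altdef sgn_mult c harmonic_monomial_unit norm_mult power_int_mult_distrib)
qed simp

lemma AE_dA_nonzero: "AE z in dA. z \<noteq> 0"
proof (rule AE_I[where N = "{0}"])
  have "emeasure dA ({0} \<inter> unit_disk) = 0"
    by (subst emeasure_dA) (auto simp: emeasure_lborel_countable)
  moreover have "{0} \<inter> unit_disk = {0}" by auto
  ultimately show "emeasure dA {0} = 0" by simp
  have "{0} \<inter> unit_disk \<in> sets (lebesgue_on unit_disk)"
    by (subst sets_restrict_space_iff) auto
  then show "{0} \<in> sets dA" by simp
qed auto

lemma power2_powr:
  fixes x a :: real
  assumes "x \<ge> 0"
  shows "(x\<^sup>2) powr a = x powr (2 * a)"
proof (cases "x = 0")
  case False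
  then have "x\<^sup>2 = x powr 2" using assms by simp
  then show ?thesis by (simp only: powr_powr)
qed simp

lemma has_bochner_integral_dA_powr:
  assumes "s > -2" "0 \<le> R" "R \<le> 1"
  shows "has_bochner_integral dA (\<lambda>z. indicator (cball 0 R) z *\<^sub>R (norm z powr s)) (2 * R powr (s + 2) / (s + 2))"
proof -
  let ?f = "\<lambda>t::real. indicator {0..R\<^sup>2} t * t powr (s / 2)"
  let ?I = "2 * R powr (s + 2) / (s + 2)"
  have R2: "R\<^sup>2 \<le> 1" using assms by (simp add: power_le_one)
  have "((\<lambda>t. t powr (s / 2)) has_integral ((R\<^sup>2) powr (s / 2 + 1) / (s / 2 + 1))) {0..R\<^sup>2}"
    using assms by (intro has_integral_powr_from_0) auto
  moreover have "(R\<^sup>2) powr (s / 2 + 1) / (s / 2 + 1) = ?I"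
  proof -
    have "(R\<^sup>2) powr (s / 2 + 1) = R powr (s + 2)"
      using power2_powr[of R "s / 2 + 1"] assms by (simp add: algebra_simps)
    then show ?thesis using assms by (simp add: field_simps)
  qed
  ultimately have "((\<lambda>t. t powr (s / 2)) has_integral ?I) {0..R\<^sup>2}" by simp
  then have "(?f has_integral ?I) UNIV"
    by (subst (asm) has_integral_restrict_UNIV[symmetric])
      (auto elim!: has_integral_eq[rotated] simp: indicator_def)
  then have "integral\<^sup>N lborel ?f = ennreal ?I"
    by (intro nn_integral_has_integral_lborel) auto
  then have "has_bochner_integral lborel ?f ?I"
    using assms by (intro has_bochner_integral_nn_integral) auto
  moreover have "?f = (\<lambda>t. indicator {0..1} t *\<^sub>R ?f t)"
    using R2 by (auto simp: fun_eq_iff indicator_def)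
  ultimately have "has_bochner_integral lborel (\<lambda>t. indicator {0..1} t *\<^sub>R ?f t) ?I"
    by simp
  then have "has_bochner_integral (density lborel (\<lambda>t. ennreal (indicator {0..1} t))) ?f ?I"
    by (intro has_bochner_integral_density) auto
  then have "has_bochner_integral (distr dA borel (\<lambda>z. (norm z)\<^sup>2)) ?f ?I"
    by (simp add: distr_dA_square_radius ennreal_indicator)
  then have "has_bochner_integral dA (\<lambda>z. ?f ((norm z)\<^sup>2)) ?I"
    by (subst (asm) has_bochner_integral_iff)
      (auto simp: has_bochner_integral_iff integrable_distr_eq integral_distr borel_measurable_dA)
  moreover have "?f ((norm z)\<^sup>2) = indicator (cball 0 R) z *\<^sub>R (norm z powr s)" for z :: complex
  proof -
    have "(norm z)\<^sup>2 \<le> R\<^sup>2 \<longleftrightarrow> norm z \<le> R"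
      using assms by (simp add: power_mono_iff)
    moreover have "((norm z)\<^sup>2) powr (s / 2) = norm z powr s"
      using power2_powr[of "norm z" "s / 2"] by simp
    ultimately show ?thesis by (simp add: indicator_def)
  qed
  ultimately show ?thesis by simp
qed

text \<open>For \<open>k \<noteq> 0\<close> the rotation by the angle \<open>\<pi> / k\<close> preserves the measure and turns the integrand into
its negative. Closed disks of radius \<open>R \<le> 1\<close> are used because at \<open>R = 1\<close> they cover the unit
disk, while for \<open>R < 1\<close> harmonic series converge uniformly on them.\<close>

lemma has_bochner_integral_dA_quasihomogeneous:
  assumes s: "s > -2" and R: "0 \<le> R" "R \<le> 1"
  shows "has_bochner_integral dA (\<lambda>z. indicator (cball 0 R) z *\<^sub>R quasihomogeneous k s z)
    (if k = 0 then of_real (2 * R powr (s + 2) / (s + 2)) else 0)"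
proof (cases "k = 0")
  case True
  have "quasihomogeneous 0 s z = of_real (norm z powr s)" for z
    by (simp add: quasihomogeneous_def)
  then show ?thesis
    using has_bochner_integral_of_real[OF has_bochner_integral_dA_powr[OF s R], where 'a = complex] True
    by (simp add: scaleR_conv_of_real)
next
  case False
  let ?F = "\<lambda>z. indicator (cball 0 R) z *\<^sub>R quasihomogeneous k s z"
  have mF [measurable]: "?F \<in> borel_measurable borel"
    by (intro borel_measurable_scaleR borel_measurable_indicator borel_measurable_quasihomogeneous) simp
  have int: "integrable dA ?F"
  proof (rule Bochner_Integration.integrable_bound)
    show "integrable dA (\<lambda>z. indicator (cball 0 R) z *\<^sub>R (norm z powr s))"
      using has_bochner_integral_dA_powr[OF s R] by (simp add: has_bochner_integral_iff)
  qed (auto simp: borel_measurable_dA norm_quasihomogeneous)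
  define c where "c = cis (pi / of_int k)"
  have c: "norm c = 1" "c powi k = -1"
    using False by (auto simp: c_def cis_power_int)
  have "(LINT z|dA. ?F (c * z)) = (LINT z|distr dA borel (\<lambda>z. c * z). ?F z)"
    by (subst integral_distr) (auto intro!: borel_measurable_dA)
  also have "\<dots> = (LINT z|dA. ?F z)"
    unfolding distr_dA_rotation[OF c(1)]
    by (subst integral_distr) (auto intro!: borel_measurable_dA)
  also have "(\<lambda>z. ?F (c * z)) = (\<lambda>z. - ?F z)"
    by (auto simp: fun_eq_iff indicator_def quasihomogeneous_rotate c norm_mult)
  finally have "(LINT z|dA. ?F z) = 0" by simp
  then show ?thesis using int False by (simp add: has_bochner_integral_iff)
qed

section \<open>Harmonic functions as harmonic series\<close>

text \<open>Up to an error of \<open>o(t\<^sup>2)\<close>, the second difference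
\<open>f (z + t u + t v) - f (z + t u) - f (z + t v) + f z\<close>, which is symmetric in \<open>u\<close> and \<open>v\<close>, equals
\<open>t\<^sup>2 f'' u v\<close>. The estimate applies the mean value inequality to \<open>s \<mapsto> f (z + t u + s v) - f (z + s v)\<close>.\<close>

lemma second_derivative_symmetric:
  fixes f :: "'a::real_normed_vector \<Rightarrow> 'b::real_normed_vector"
    and f' :: "'a \<Rightarrow> 'a \<Rightarrow>\<^sub>L 'b" and f'' :: "'a \<Rightarrow>\<^sub>L 'a \<Rightarrow>\<^sub>L 'b"
  assumes S: "open S" "z \<in> S"
    and f: "\<And>w. w \<in> S \<Longrightarrow> (f has_derivative blinfun_apply (f' w)) (at w)"
    and f': "(f' has_derivative blinfun_apply f'') (at z)"
  shows "f'' u v = f'' v u"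
proof -
  have key: "\<exists>d>0. \<forall>t. 0 < t \<and> t < d \<longrightarrow>
      norm (f (z + t *\<^sub>R u + t *\<^sub>R v) - f (z + t *\<^sub>R u) - f (z + t *\<^sub>R v) + f z
        - (t * t) *\<^sub>R f'' u v) \<le> e * (2 * (norm u + norm v)) * norm v * (t * t)"
    if e: "e > 0" for e :: real and u v
  proof -
    obtain d1 where d1: "d1 > 0" "ball z d1 \<subseteq> S"
      using S openE by blast
    obtain d2 where d2: "d2 > 0"
      "\<And>y. norm (y - z) < d2 \<Longrightarrow> norm (f' y - f' z - f'' (y - z)) \<le> e * norm (y - z)"
      using f' e unfolding has_derivative_at_alt by blast
    \<comment> \<open>All points of the parallelogram spanned by \<open>t u\<close> and \<open>t v\<close> stay within distance
      \<open>min d1 d2\<close> of \<open>z\<close>; adding \<open>1\<close> avoids a division by zero.\<close>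
    define d where "d = min d1 d2 / (norm u + norm v + 1)"
    have d: "d > 0" unfolding d_def using d1 d2
      by (intro divide_pos_pos) (auto simp: add_nonneg_pos)
    show ?thesis
    proof (intro exI[of _ d] conjI allI impI d)
      fix t :: real assume t: "0 < t \<and> t < d"
      have tb: "t * (norm u + norm v) < min d1 d2"
      proof -
        have "t * (norm u + norm v) \<le> t * (norm u + norm v + 1)" using t by simp
        also have "\<dots> < min d1 d2"
          using t unfolding d_def by (simp add: pos_less_divide_eq add_nonneg_pos)
        finally show ?thesis .
      qed
      have near: "norm (a *\<^sub>R u + b *\<^sub>R v) \<le> t * (norm u + norm v)"
        if "0 \<le> a" "a \<le> t" "0 \<le> b" "b \<le> t" for a b
      proof -
        have "norm (a *\<^sub>R u + b *\<^sub>R v) \<le> a * norm u + b * norm v"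
          using that norm_triangle_ineq[of "a *\<^sub>R u" "b *\<^sub>R v"] by simp
        also have "\<dots> \<le> t * norm u + t * norm v"
          using that by (intro add_mono mult_right_mono) auto
        finally show ?thesis by (simp add: algebra_simps)
      qed
      let ?\<psi> = "\<lambda>s. f (z + t *\<^sub>R u + s *\<^sub>R v) - f (z + s *\<^sub>R v) - (s * t) *\<^sub>R f'' u v"
      let ?D = "\<lambda>s h. h *\<^sub>R (f' (z + t *\<^sub>R u + s *\<^sub>R v) v - f' (z + s *\<^sub>R v) v - t *\<^sub>R f'' u v)"
      have inS: "z + a *\<^sub>R u + b *\<^sub>R v \<in> S" if "0 \<le> a" "a \<le> t" "0 \<le> b" "b \<le> t" for a b
      proof -
        have "norm (a *\<^sub>R u + b *\<^sub>R v) < d1"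
          using near[OF that] tb by linarith
        moreover have "dist z (z + a *\<^sub>R u + b *\<^sub>R v) = norm (a *\<^sub>R u + b *\<^sub>R v)"
            by (metis add.assoc add_diff_cancel_left' dist_commute dist_norm)
        ultimately have "z + a *\<^sub>R u + b *\<^sub>R v \<in> ball z d1"
            by simp
        then show ?thesis using d1 by blast
      qed
      have "norm (?\<psi> t - ?\<psi> 0) \<le> (e * (2 * (norm u + norm v)) * norm v * t) * norm (t - 0)"
      proof (rule differentiable_bound[of "{0..t}"])
        fix s assume s: "s \<in> {0..t}"
        show "(?\<psi> has_derivative ?D s) (at s within {0..t})"
        proof -
          have 1: "((\<lambda>s. f (z + a *\<^sub>R u + s *\<^sub>R v)) has_derivative (\<lambda>h. f' (z + a *\<^sub>R u + s *\<^sub>R v) (h *\<^sub>R v))) (at s within {0..t})"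
            if "0 \<le> a" "a \<le> t" for a
          proof (rule has_derivative_compose[where f="\<lambda>s. z + a *\<^sub>R u + s *\<^sub>R v"])
            show "((\<lambda>s. z + a *\<^sub>R u + s *\<^sub>R v) has_derivative (\<lambda>h. h *\<^sub>R v)) (at s within {0..t})"
              by (auto intro!: derivative_eq_intros)
            show "(f has_derivative blinfun_apply (f' (z + a *\<^sub>R u + s *\<^sub>R v))) (at (z + a *\<^sub>R u + s *\<^sub>R v))"
              using s that by (intro f inS) auto
          qed
          have 2: "((\<lambda>s. (s * t) *\<^sub>R f'' u v) has_derivative (\<lambda>h. (h * t) *\<^sub>R f'' u v)) (at s within {0..t})"
            by (auto intro!: derivative_eq_intros)
          have t0: "0 \<le> t" using t by simp
          show ?thesis
            using has_derivative_diff[OF has_derivative_diff[OF 1[OF t0 order_refl] 1[OF order_refl t0]] 2]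
            by (simp add: fun_eq_iff blinfun.scaleR_right scaleR_diff_right mult.commute)
        qed
        show "onorm (?D s) \<le> e * (2 * (norm u + norm v)) * norm v * t"
        proof (rule onorm_le)
          fix h :: real
          have A: "norm (f' (z + a *\<^sub>R u + s *\<^sub>R v) - f' z - f'' (a *\<^sub>R u + s *\<^sub>R v)) \<le> e * (t * (norm u + norm v))"
            if "0 \<le> a" "a \<le> t" for a
          proof -
            have n: "norm (a *\<^sub>R u + s *\<^sub>R v) \<le> t * (norm u + norm v)" using s that by (intro near) auto
            have "norm (f' (z + a *\<^sub>R u + s *\<^sub>R v) - f' z - f'' (a *\<^sub>R u + s *\<^sub>R v)) \<le> e * norm (a *\<^sub>R u + s *\<^sub>R v)"
              using d2(2)[of "z + a *\<^sub>R u + s *\<^sub>R v"] n tb by (simp add: add.assoc)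
            also have "\<dots> \<le> e * (t * (norm u + norm v))"
              using e n by (intro mult_left_mono) auto
            finally show ?thesis .
          qed
          let ?p = "f' (z + t *\<^sub>R u + s *\<^sub>R v)" and ?q = "f' (z + s *\<^sub>R v)"
          have "?p v - ?q v - t *\<^sub>R f'' u v = ((?p - f' z - f'' (t *\<^sub>R u + s *\<^sub>R v)) - (?q - f' z - f'' (s *\<^sub>R v))) v"
            by (simp add: blinfun.diff_left blinfun.add_left blinfun.add_right blinfun.scaleR_left blinfun.scaleR_right)
          also have "norm \<dots> \<le> norm ((?p - f' z - f'' (t *\<^sub>R u + s *\<^sub>R v)) - (?q - f' z - f'' (s *\<^sub>R v))) * norm v"
            by (rule norm_blinfun)
          also have "\<dots> \<le> (e * (t * (norm u + norm v)) + e * (t * (norm u + norm v))) * norm v"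
            using A[of t] A[of 0] t
            by (intro mult_right_mono order_trans[OF norm_triangle_ineq4 add_mono]) simp_all
          finally have "norm (?p v - ?q v - t *\<^sub>R f'' u v) \<le> e * (2 * (norm u + norm v)) * norm v * t"
            by (simp add: algebra_simps)
          from mult_right_mono[OF this, of "norm h"]
          show "norm (?D s h) \<le> e * (2 * (norm u + norm v)) * norm v * t * norm h"
            by (simp add: mult.commute)
        qed
      qed (use t in auto)
      then show "norm (f (z + t *\<^sub>R u + t *\<^sub>R v) - f (z + t *\<^sub>R u) - f (z + t *\<^sub>R v) + f z
        - (t * t) *\<^sub>R f'' u v) \<le> e * (2 * (norm u + norm v)) * norm v * (t * t)"
        using t by (simp add: algebra_simps)
    qed
  qed
  have bound: "norm (f'' u v - f'' v u) \<le> e * (2 * (norm u + norm v) * (norm u + norm v))"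
    if e: "e > 0" for e :: real
  proof -
    obtain d1 where d1: "d1 > 0" "\<And>t. 0 < t \<Longrightarrow> t < d1 \<Longrightarrow>
      norm (f (z + t *\<^sub>R u + t *\<^sub>R v) - f (z + t *\<^sub>R u) - f (z + t *\<^sub>R v) + f z
        - (t * t) *\<^sub>R f'' u v) \<le> e * (2 * (norm u + norm v)) * norm v * (t * t)"
      using key[OF e, of u v] by blast
    obtain d2 where d2: "d2 > 0" "\<And>t. 0 < t \<Longrightarrow> t < d2 \<Longrightarrow>
      norm (f (z + t *\<^sub>R v + t *\<^sub>R u) - f (z + t *\<^sub>R v) - f (z + t *\<^sub>R u) + f z
        - (t * t) *\<^sub>R f'' v u) \<le> e * (2 * (norm v + norm u)) * norm u * (t * t)"
      using key[OF e, of v u] by blast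
    define t where "t = min d1 d2 / 2"
    have t: "0 < t" "t < d1" "t < d2" using d1 d2 by (auto simp: t_def)
    let ?\<Delta> = "f (z + t *\<^sub>R u + t *\<^sub>R v) - f (z + t *\<^sub>R u) - f (z + t *\<^sub>R v) + f z"
    have "norm ((t * t) *\<^sub>R (f'' u v - f'' v u))
        = norm ((?\<Delta> - (t * t) *\<^sub>R f'' v u) - (?\<Delta> - (t * t) *\<^sub>R f'' u v))"
      by (simp add: algebra_simps)
    also have "\<dots> \<le> e * (2 * (norm v + norm u)) * norm u * (t * t) + e * (2 * (norm u + norm v)) * norm v * (t * t)"
    proof (rule order_trans[OF norm_triangle_ineq4 add_mono])
      have "?\<Delta> = f (z + t *\<^sub>R v + t *\<^sub>R u) - f (z + t *\<^sub>R v) - f (z + t *\<^sub>R u) + f z"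
        unfolding add.assoc[of z] add.commute[of "t *\<^sub>R u" "t *\<^sub>R v"]
        by (rule arg_cong[where f = "\<lambda>x. x + f z"]) (simp add: algebra_simps)
      then show "norm (?\<Delta> - (t * t) *\<^sub>R f'' v u) \<le> e * (2 * (norm v + norm u)) * norm u * (t * t)"
        using d2(2)[of t] t by (simp only:)
    qed (use d1 t in blast)
    also have "\<dots> = (t * t) * (e * (2 * (norm u + norm v) * (norm u + norm v)))"
      by (simp add: algebra_simps)
    finally show ?thesis using t by simp
  qed
  have "norm (f'' u v - f'' v u) \<le> 0 + e" if e: "e > 0" for e :: real
  proof -
    let ?K = "2 * (norm u + norm v) * (norm u + norm v)"
    have K: "?K \<ge> 0" by simp
    have "norm (f'' u v - f'' v u) \<le> e / (?K + 1) * ?K"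
      using K e by (intro bound) (auto intro!: divide_pos_pos add_nonneg_pos)
    also have "\<dots> \<le> e"
      using K e by (simp add: divide_simps add_nonneg_pos mult_left_mono)
    finally show ?thesis by simp
  qed
  then have "norm (f'' u v - f'' v u) \<le> 0"
    by (rule field_le_epsilon)
  then show ?thesis by simp
qed

lemma harmonic_on_bounded_linear:
  assumes "harmonic_on S f" "bounded_linear M"
  shows "harmonic_on S (\<lambda>z. M (f z))"
proof -
  obtain f' f'' where f:
    "\<And>z. z \<in> S \<Longrightarrow> (f has_derivative blinfun_apply (f' z)) (at z)"
    "\<And>z. z \<in> S \<Longrightarrow> (f' has_derivative blinfun_apply (f'' z)) (at z)" "continuous_on S f''"
    "\<And>z. z \<in> S \<Longrightarrow> blinfun_apply (blinfun_apply (f'' z) 1) 1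
              + blinfun_apply (blinfun_apply (f'' z) \<i>) \<i> = 0"
    using assms(1) unfolding harmonic_on_def by blast
  define L where "L = Blinfun M"
  have L: "blinfun_apply L = M"
    unfolding L_def by (simp add: bounded_linear_Blinfun_apply assms(2))
  define P :: "(complex \<Rightarrow>\<^sub>L complex) \<Rightarrow>\<^sub>L (complex \<Rightarrow>\<^sub>L complex)" where "P = Blinfun (\<lambda>g. L o\<^sub>L g)"
  have bl: "bounded_linear (\<lambda>g. L o\<^sub>L g :: complex \<Rightarrow>\<^sub>L complex)"
    by (rule bounded_bilinear.bounded_linear_right[OF bounded_bilinear_blinfun_compose])
  have P: "blinfun_apply P g = L o\<^sub>L g" for g
    unfolding P_def by (simp add: bounded_linear_Blinfun_apply bl)
  show ?thesis unfolding harmonic_on_def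
  proof (intro exI conjI ballI)
    fix z assume z: "z \<in> S"
    show "((\<lambda>z. M (f z)) has_derivative blinfun_apply (L o\<^sub>L f' z)) (at z)"
      using bounded_linear.has_derivative[OF assms(2) f(1)[OF z]]
      by (rule has_derivative_eq_rhs) (simp add: L fun_eq_iff)
    show "((\<lambda>z. L o\<^sub>L f' z) has_derivative blinfun_apply (P o\<^sub>L f'' z)) (at z)"
      using bounded_linear.has_derivative[OF bl f(2)[OF z]]
      by (rule has_derivative_eq_rhs) (simp add: P fun_eq_iff)
    show "blinfun_apply (blinfun_apply (P o\<^sub>L f'' z) 1) 1
              + blinfun_apply (blinfun_apply (P o\<^sub>L f'' z) \<i>) \<i> = 0"
      using f(4)[OF z] linear_0[OF bounded_linear.linear[OF assms(2)]]
      by (simp add: P L flip: linear_add[OF bounded_linear.linear[OF assms(2)]])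
  qed (intro continuous_intros f)
qed

lemma harmonic_on_holomorphic:
  assumes "open S" "f holomorphic_on S"
  shows "harmonic_on S f"
proof -
  let ?P = "Blinfun blinfun_mult_right :: complex \<Rightarrow>\<^sub>L complex \<Rightarrow>\<^sub>L complex"
  have P: "blinfun_apply ?P = blinfun_mult_right"
    by (simp add: bounded_linear_Blinfun_apply bounded_linear_blinfun_mult_right)
  note h1 = holomorphic_deriv[OF assms(2,1)]
  note h2 = holomorphic_deriv[OF h1 assms(1)]
  show ?thesis
    unfolding harmonic_on_def
  proof (intro exI conjI ballI)
    fix z assume z: "z \<in> S"
    show "(f has_derivative blinfun_apply (blinfun_mult_right (deriv f z))) (at z)"
      using holomorphic_derivI[OF assms(2,1) z] by (simp add: has_field_derivative_def)
    show "((\<lambda>z. blinfun_mult_right (deriv f z)) has_derivative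
        blinfun_apply (?P o\<^sub>L blinfun_mult_right (deriv (deriv f) z))) (at z)"
      using bounded_linear.has_derivative[OF bounded_linear_blinfun_mult_right
          holomorphic_derivI[OF h1 assms(1) z, THEN has_field_derivative_imp_has_derivative]]
      by (rule has_derivative_eq_rhs) (simp add: P fun_eq_iff)
    show "blinfun_apply (blinfun_apply (?P o\<^sub>L blinfun_mult_right (deriv (deriv f) z)) 1) 1
        + blinfun_apply (blinfun_apply (?P o\<^sub>L blinfun_mult_right (deriv (deriv f) z)) \<i>) \<i> = 0"
      by (simp add: P mult.assoc)
  next
    show "continuous_on S (\<lambda>z. ?P o\<^sub>L blinfun_mult_right (deriv (deriv f) z))"
      by (intro continuous_intros bounded_linear.continuous_on[OF bounded_linear_blinfun_mult_right]
          holomorphic_on_imp_continuous_on h2)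
  qed
qed

text \<open>By the symmetry of the second derivative and the Laplace equation, \<open>(f\<^sub>x - i f\<^sub>y) / 2\<close> satisfies
the Cauchy-Riemann equations. If \<open>\<phi>\<close> is a holomorphic primitive of it, then the derivative of
\<open>f - \<phi>\<close> is conjugate linear, so the conjugate of \<open>f - \<phi>\<close> is holomorphic.\<close>

lemma harmonic_on_holomorphic_decomposition:
  assumes S: "open S" "convex S" and harm: "harmonic_on S f"
  obtains \<phi> \<psi> where "\<phi> holomorphic_on S" "\<psi> holomorphic_on S"
    "\<And>z. f z = \<phi> z + cnj (\<psi> z)"
proof -
  obtain f' f'' where f:
    "\<And>z. z \<in> S \<Longrightarrow> (f has_derivative blinfun_apply (f' z)) (at z)"
    "\<And>z. z \<in> S \<Longrightarrow> (f' has_derivative blinfun_apply (f'' z)) (at z)" "continuous_on S f''"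
    "\<And>z. z \<in> S \<Longrightarrow> blinfun_apply (blinfun_apply (f'' z) 1) 1
              + blinfun_apply (blinfun_apply (f'' z) \<i>) \<i> = 0"
    using harm unfolding harmonic_on_def by blast
  define h where "h z = (f' z 1 - \<i> * f' z \<i>) / 2" for z
  have split: "F w = Re w *\<^sub>R F 1 + Im w *\<^sub>R F \<i>" for F :: "complex \<Rightarrow>\<^sub>L 'c::real_normed_vector" and w
  proof -
    have "w = Re w *\<^sub>R 1 + Im w *\<^sub>R \<i>" by (simp add: complex_eq_iff)
    then have "F w = F (Re w *\<^sub>R 1 + Im w *\<^sub>R \<i>)" by (rule arg_cong)
    also have "\<dots> = Re w *\<^sub>R F 1 + Im w *\<^sub>R F \<i>"
      by (simp only: blinfun.add_right blinfun.scaleR_right)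
    finally show ?thesis .
  qed
  have bl: "bounded_linear (\<lambda>g :: complex \<Rightarrow>\<^sub>L complex. (g 1 - \<i> * g \<i>) / 2)"
  proof -
    have "bounded_linear (\<lambda>g :: complex \<Rightarrow>\<^sub>L complex. \<i> * g \<i>)"
      by (rule bounded_linear_compose[OF bounded_linear_mult_right blinfun.bounded_linear_left])
    then have "bounded_linear (\<lambda>g :: complex \<Rightarrow>\<^sub>L complex. g 1 - \<i> * g \<i>)"
      by (rule bounded_linear_sub[OF blinfun.bounded_linear_left])
    then show ?thesis
      by (rule bounded_linear_compose[OF bounded_linear_divide])
  qed
  have "h field_differentiable at z" if z: "z \<in> S" for z
  proof -
    have sym: "f'' z \<i> 1 = f'' z 1 \<i>"
      by (rule second_derivative_symmetric[OF S(1) z f(1) f(2)[OF z]])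
    have lap: "f'' z \<i> \<i> = - f'' z 1 1"
      using f(4)[OF z] by (simp add: add_eq_0_iff)
    let ?d = "(f'' z 1 1 - \<i> * f'' z 1 \<i>) / 2"
    have "(h has_derivative (\<lambda>w. (f'' z w 1 - \<i> * f'' z w \<i>) / 2)) (at z)"
      unfolding h_def
      by (rule bounded_linear.has_derivative[OF bl f(2)[OF z]])
    moreover have "(f'' z w 1 - \<i> * f'' z w \<i>) / 2 = ?d * w" for w
    proof -
      have "(f'' z w 1 - \<i> * f'' z w \<i>) / 2 = ?d * (of_real (Re w) + \<i> * of_real (Im w))"
        unfolding split[of "f'' z" w]
        by (simp add: blinfun.add_left blinfun.scaleR_left sym lap scaleR_conv_of_real field_simps)
      then show ?thesis by (simp flip: complex_eq)
    qed
    ultimately have "(h has_derivative (\<lambda>w. ?d * w)) (at z)"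
      by (rule has_derivative_eq_rhs[OF _ ext])
    then have "(h has_field_derivative ?d) (at z)"
      by (simp only: has_field_derivative_def)
    then show ?thesis by (auto simp: field_differentiable_def)
  qed
  then have "h holomorphic_on S"
    using S(1) by (simp add: holomorphic_on_open field_differentiable_def)
  then obtain \<phi> where \<phi>: "\<And>z. z \<in> S \<Longrightarrow> (\<phi> has_field_derivative h z) (at z)"
    using holomorphic_convex_primitive'[OF S(2,1)] S(1) by (metis at_within_open)
  define \<psi> where "\<psi> z = cnj (f z - \<phi> z)" for z
  have "(\<psi> has_field_derivative cnj ((f' z 1 + \<i> * f' z \<i>) / 2)) (at z)" if z: "z \<in> S" for z
  proof -
    have "(\<psi> has_derivative (\<lambda>w. cnj (f' z w - h z * w))) (at z)"
      unfolding \<psi>_def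
      by (intro bounded_linear.has_derivative[OF bounded_linear_cnj] has_derivative_diff f(1)[OF z]
          \<phi>[OF z, THEN has_field_derivative_imp_has_derivative])
    moreover have "f' z w - h z * w = (f' z 1 + \<i> * f' z \<i>) / 2 * cnj w" for w
    proof -
      have w: "w = of_real (Re w) + \<i> * of_real (Im w)" by (rule complex_eq)
      have cw: "cnj w = of_real (Re w) - \<i> * of_real (Im w)" by (simp add: complex_eq_iff)
      have "f' z w - h z * w = (of_real (Re w) * f' z 1 + of_real (Im w) * f' z \<i>)
          - h z * (of_real (Re w) + \<i> * of_real (Im w))"
        unfolding split[of "f' z" w] arg_cong[OF w, of "\<lambda>x. h z * x"]
        by (simp only: scaleR_conv_of_real)
      also have "\<dots> = (f' z 1 + \<i> * f' z \<i>) / 2 * cnj w"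
        unfolding cw h_def by (simp add: field_simps)
      finally show ?thesis .
    qed
    ultimately have "(\<psi> has_derivative (\<lambda>w. cnj ((f' z 1 + \<i> * f' z \<i>) / 2 * cnj w))) (at z)"
      by (simp only:)
    then show ?thesis
      unfolding has_field_derivative_def
      by (rule has_derivative_eq_rhs) (simp add: fun_eq_iff)
  qed
  then have "\<psi> holomorphic_on S"
    using S(1) by (auto simp: holomorphic_on_open)
  moreover have "\<phi> holomorphic_on S"
    using S(1) \<phi> by (auto simp: holomorphic_on_open)
  moreover have "f z = \<phi> z + cnj (\<psi> z)" for z by (simp add: \<psi>_def)
  ultimately show ?thesis using that by blast
qed

lemma sum_symmetric_interval_Suc:
  "sum g {- int (Suc N)..int (Suc N)} = sum g {- int N..int N} + (g (int (Suc N)) + g (- int (Suc N)))"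
  for g :: "int \<Rightarrow> 'a::comm_monoid_add"
proof -
  have "{- int (Suc N)..int (Suc N)} = insert (int (Suc N)) (insert (- int (Suc N)) {- int N..int N})"
    by auto
  then show ?thesis by (simp add: ac_simps)
qed

lemma sum_symmetric_interval:
  "sum g {- int N..int N} = (\<Sum>j\<le>N. g (int j)) + (\<Sum>j\<le>N. g (- int j)) - g 0"
  for g :: "int \<Rightarrow> 'a::ab_group_add"
proof (induction N)
  case (Suc N)
  then show ?case
    by (subst sum_symmetric_interval_Suc) (simp add: algebra_simps)
qed simp

definition harmonic_sum :: "(int \<Rightarrow> complex) \<Rightarrow> nat \<Rightarrow> complex \<Rightarrow> complex" where
  "harmonic_sum a N z = (\<Sum>n\<in>{- int N..int N}. a n * harmonic_monomial n z)"

text \<open>The two-sided series is summed symmetrically. The summability condition is absolute convergence,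
uniform on every smaller disk; it supplies the dominating constants for passing to the limit under
an integral.\<close>

definition has_harmonic_series :: "(complex \<Rightarrow> complex) \<Rightarrow> (int \<Rightarrow> complex) \<Rightarrow> bool" where
  "has_harmonic_series f a \<longleftrightarrow>
     (\<forall>r. 0 \<le> r \<and> r < 1 \<longrightarrow> summable (\<lambda>n. (norm (a (int n)) + norm (a (- int n))) * r ^ n)) \<and>
     (\<forall>z\<in>unit_disk. (\<lambda>N. harmonic_sum a N z) \<longlonglongrightarrow> f z)"

lemma has_harmonic_series_power_series:
  assumes A: "\<And>z. z \<in> unit_disk \<Longrightarrow> (\<lambda>n. A n * z ^ n) sums \<phi> z"
    and B: "\<And>z. z \<in> unit_disk \<Longrightarrow> (\<lambda>n. B n * z ^ n) sums \<psi> z"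
  shows "has_harmonic_series (\<lambda>z. \<phi> z + cnj (\<psi> z))
    (\<lambda>n. if n > 0 then A (nat n) else if n < 0 then cnj (B (nat (- n))) else A 0 + cnj (B 0))"
    (is "has_harmonic_series _ ?a")
  unfolding has_harmonic_series_def
proof (intro conjI allI impI ballI)
  fix r :: real assume r: "0 \<le> r \<and> r < 1"
  define t where "t = (r + 1) / 2"
  have t: "r < t" "t < 1" "0 < t" using r by (auto simp: t_def)
  have S: "summable (\<lambda>n. norm (C n) * r ^ n)"
    if "\<And>z. z \<in> unit_disk \<Longrightarrow> (\<lambda>n. C n * z ^ n) sums g z" for C g
  proof -
    have "summable (\<lambda>n. C n * (of_real t :: complex) ^ n)"
      using that[of "of_real t"] t by (auto simp: sums_iff)
    then have "summable (\<lambda>n. norm (C n * (of_real r :: complex) ^ n))"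
      by (rule powser_insidea) (use r t in auto)
    then show ?thesis using r by (simp add: norm_mult norm_power)
  qed
  have "summable (\<lambda>n. 2 * (norm (A n) * r ^ n + norm (B n) * r ^ n))"
    by (intro summable_mult summable_add S[OF A] S[OF B])
  then show "summable (\<lambda>n. (norm (?a (int n)) + norm (?a (- int n))) * r ^ n)"
  proof (rule summable_comparison_test'[where N = 0])
    fix n :: nat
    have "norm (?a (int n)) + norm (?a (- int n)) \<le> 2 * (norm (A n) + norm (B n))"
      using norm_triangle_ineq[of "A 0" "cnj (B 0)"] by (cases "n = 0") auto
    then have "(norm (?a (int n)) + norm (?a (- int n))) * r ^ n \<le> 2 * (norm (A n) + norm (B n)) * r ^ n"
      using r by (intro mult_right_mono) auto
    moreover have "0 \<le> (norm (?a (int n)) + norm (?a (- int n))) * r ^ n"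
      using r by simp
    ultimately show "norm ((norm (?a (int n)) + norm (?a (- int n))) * r ^ n)
        \<le> 2 * (norm (A n) * r ^ n + norm (B n) * r ^ n)"
      by (simp only: real_norm_def abs_of_nonneg) (simp add: algebra_simps)
  qed
next
  fix z :: complex assume z: "z \<in> unit_disk"
  have "harmonic_sum ?a N z = (\<Sum>n<Suc N. A n * z ^ n) + cnj (\<Sum>n<Suc N. B n * z ^ n)" for N
  proof (induction N)
    case 0
    then show ?case by (simp add: harmonic_sum_def harmonic_monomial_def)
  next
    case (Suc N)
    have "harmonic_sum ?a (Suc N) z = harmonic_sum ?a N z
        + (A (Suc N) * z ^ Suc N + cnj (B (Suc N)) * cnj z ^ Suc N)"
      unfolding harmonic_sum_def sum_symmetric_interval_Suc
      by (simp add: harmonic_monomial_def nat_add_distrib)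
    then show ?case
      unfolding Suc.IH by simp
  qed
  moreover have "(\<lambda>N. (\<Sum>n<Suc N. A n * z ^ n) + cnj (\<Sum>n<Suc N. B n * z ^ n)) \<longlonglongrightarrow> \<phi> z + cnj (\<psi> z)"
    using A[OF z] B[OF z] unfolding sums_def
    by (intro tendsto_intros LIMSEQ_Suc)
  ultimately show "(\<lambda>N. harmonic_sum ?a N z) \<longlonglongrightarrow> \<phi> z + cnj (\<psi> z)"
    by simp
qed

lemma harmonic_on_imp_has_harmonic_series:
  assumes "harmonic_on unit_disk f"
  obtains a where "has_harmonic_series f a"
proof -
  obtain \<phi> \<psi> where hol: "\<phi> holomorphic_on unit_disk" "\<psi> holomorphic_on unit_disk"
    and f: "\<And>z. f z = \<phi> z + cnj (\<psi> z)"
    using harmonic_on_holomorphic_decomposition[OF open_ball convex_ball assms] by blast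
  have "f = (\<lambda>z. \<phi> z + cnj (\<psi> z))" by (rule ext) (rule f)
  moreover have "has_harmonic_series (\<lambda>z. \<phi> z + cnj (\<psi> z))
      (\<lambda>n. if n > 0 then (deriv ^^ nat n) \<phi> 0 / fact (nat n)
           else if n < 0 then cnj ((deriv ^^ nat (- n)) \<psi> 0 / fact (nat (- n)))
           else (deriv ^^ 0) \<phi> 0 / fact 0 + cnj ((deriv ^^ 0) \<psi> 0 / fact 0))"
    using holomorphic_power_series[OF hol(1)] holomorphic_power_series[OF hol(2)]
    by (intro has_harmonic_series_power_series) simp_all
  ultimately show ?thesis
    using that by simp
qed

lemma ex_harmonic_has_harmonic_series:
  assumes "\<And>r. 0 \<le> r \<Longrightarrow> r < 1 \<Longrightarrow> summable (\<lambda>n. (norm (a (int n)) + norm (a (- int n))) * r ^ n)"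
  obtains f where "harmonic_on unit_disk f" "has_harmonic_series f a"
proof -
  define A where "A n = a (int n)" for n
  define B where "B n = (if n = 0 then 0 else cnj (a (- int n)))" for n
  have S: "(\<lambda>n. C n * z ^ n) sums (\<Sum>n. C n * z ^ n)"
    if z: "z \<in> unit_disk" and C: "\<And>n. norm (C n) \<le> norm (a (int n)) + norm (a (- int n))" for C z
  proof (rule summable_sums, rule summable_comparison_test'[where N = 0])
    show "summable (\<lambda>n. (norm (a (int n)) + norm (a (- int n))) * norm z ^ n)"
      using z by (intro assms) auto
    show "norm (C n * z ^ n) \<le> (norm (a (int n)) + norm (a (- int n))) * norm z ^ n" for n
      unfolding norm_mult norm_power by (intro mult_right_mono C) auto
  qed
  define \<phi> where "\<phi> z = (\<Sum>n. A n * z ^ n)" for z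
  define \<psi> where "\<psi> z = (\<Sum>n. B n * z ^ n)" for z
  have \<phi>: "(\<lambda>n. A n * z ^ n) sums \<phi> z" if "z \<in> unit_disk" for z
    unfolding \<phi>_def by (rule S[OF that]) (auto simp: A_def)
  have \<psi>: "(\<lambda>n. B n * z ^ n) sums \<psi> z" if "z \<in> unit_disk" for z
    unfolding \<psi>_def by (rule S[OF that]) (auto simp: B_def)
  have "\<phi> holomorphic_on unit_disk"
    by (rule power_series_holomorphic[where a = A]) (use \<phi> in simp)
  moreover have "\<psi> holomorphic_on unit_disk"
    by (rule power_series_holomorphic[where a = B]) (use \<psi> in simp)
  ultimately have "harmonic_on unit_disk (\<lambda>z. \<phi> z + cnj (\<psi> z))"
    by (intro harmonic_on_add harmonic_on_bounded_linear[OF _ bounded_linear_cnj]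
        harmonic_on_holomorphic) auto
  moreover have "has_harmonic_series (\<lambda>z. \<phi> z + cnj (\<psi> z)) a"
    using has_harmonic_series_power_series[OF \<phi> \<psi>]
    by (rule back_subst[of "has_harmonic_series _"]) (auto simp: A_def B_def fun_eq_iff)
  ultimately show ?thesis using that by blast
qed

lemma has_harmonic_series_linear:
  assumes "has_harmonic_series f a" "has_harmonic_series g b"
  shows "has_harmonic_series (\<lambda>z. f z + c * g z) (\<lambda>n. a n + c * b n)"
  unfolding has_harmonic_series_def
proof (intro conjI allI impI ballI)
  fix r :: real assume r: "0 \<le> r \<and> r < 1"
  have "summable (\<lambda>n. (norm (a (int n)) + norm (a (- int n))) * r ^ n
      + norm c * ((norm (b (int n)) + norm (b (- int n))) * r ^ n))"
    using assms r unfolding has_harmonic_series_def by (intro summable_add summable_mult) blast+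
  then show "summable (\<lambda>n. (norm (a (int n) + c * b (int n)) + norm (a (- int n) + c * b (- int n))) * r ^ n)"
  proof (rule summable_comparison_test'[where N = 0])
    fix n :: nat
    have "norm (a m + c * b m) \<le> norm (a m) + norm c * norm (b m)" for m
      using norm_triangle_ineq[of "a m" "c * b m"] by (simp add: norm_mult)
    then have "(norm (a (int n) + c * b (int n)) + norm (a (- int n) + c * b (- int n))) * r ^ n
        \<le> ((norm (a (int n)) + norm c * norm (b (int n))) + (norm (a (- int n)) + norm c * norm (b (- int n)))) * r ^ n"
      using r by (intro mult_right_mono add_mono) auto
    then show "norm ((norm (a (int n) + c * b (int n)) + norm (a (- int n) + c * b (- int n))) * r ^ n)
        \<le> (norm (a (int n)) + norm (a (- int n))) * r ^ n
          + norm c * ((norm (b (int n)) + norm (b (- int n))) * r ^ n)"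
      using r by (simp add: abs_mult algebra_simps)
  qed
next
  fix z assume z: "z \<in> unit_disk"
  have "harmonic_sum (\<lambda>n. a n + c * b n) N z = harmonic_sum a N z + c * harmonic_sum b N z" for N
    by (simp add: harmonic_sum_def sum.distrib sum_distrib_left algebra_simps)
  then show "(\<lambda>N. harmonic_sum (\<lambda>n. a n + c * b n) N z) \<longlonglongrightarrow> f z + c * g z"
    using assms z unfolding has_harmonic_series_def by (auto intro!: tendsto_intros)
qed

lemma has_harmonic_series_finite_sum:
  "has_harmonic_series (harmonic_sum a N) (\<lambda>n. if \<bar>n\<bar> \<le> int N then a n else 0)"
    (is "has_harmonic_series _ ?a")
  unfolding has_harmonic_series_def
proof (intro conjI allI impI ballI)
  fix r :: real
  show "summable (\<lambda>n. (norm (?a (int n)) + norm (?a (- int n))) * r ^ n)"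
    by (rule summable_finite[of "{..N}"]) auto
next
  fix z :: complex
  have "harmonic_sum ?a M z = harmonic_sum a N z" if "M \<ge> N" for M
    unfolding harmonic_sum_def using that
    by (intro sum.mono_neutral_cong_right) auto
  then show "(\<lambda>M. harmonic_sum ?a M z) \<longlonglongrightarrow> harmonic_sum a N z"
    by (intro tendsto_eventually eventually_sequentiallyI[of N]) auto
qed

section \<open>Parseval identity for the harmonic Bergman space\<close>

lemma cnj_harmonic_monomial: "cnj (harmonic_monomial n z) = harmonic_monomial (- n) z"
  by (cases n "0::int" rule: linorder_cases) (auto simp: harmonic_monomial_def)

lemma borel_measurable_harmonic_monomial [measurable]: "harmonic_monomial n \<in> borel_measurable borel"
  by (rule borel_measurable_continuous_onI[OF continuous_on_harmonic_monomial])

lemma borel_measurable_harmonic_sum: "harmonic_sum a N \<in> borel_measurable borel"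
proof -
  have "harmonic_sum a N = (\<lambda>z. \<Sum>n\<in>{- int N..int N}. a n * harmonic_monomial n z)"
    by (simp add: fun_eq_iff harmonic_sum_def)
  then show ?thesis by simp
qed

lemma has_bochner_integral_harmonic_monomials:
  assumes R: "0 \<le> R" "R \<le> 1"
  shows "has_bochner_integral dA
    (\<lambda>z. indicator (cball 0 R) z *\<^sub>R (harmonic_monomial n z * cnj (harmonic_monomial m z)))
    (if n = m then of_real (R ^ (2 * nat \<bar>n\<bar> + 2) / (of_int \<bar>n\<bar> + 1)) else 0)"
proof -
  define s where "s = real_of_int \<bar>n\<bar> + real_of_int \<bar>m\<bar>"
  have s: "s > -2" by (simp add: s_def)
  have eq: "quasihomogeneous (n - m) s z = harmonic_monomial n z * cnj (harmonic_monomial m z)"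
    if "z \<noteq> 0" for z
    using that quasihomogeneous_mult[of n "real_of_int \<bar>n\<bar>" z "- m" "real_of_int \<bar>- m\<bar>"]
      quasihomogeneous_eq_harmonic_monomial[OF that, of n] quasihomogeneous_eq_harmonic_monomial[OF that, of "- m"]
    by (simp add: s_def cnj_harmonic_monomial)
  have val: "2 * R powr (s + 2) / (s + 2) = R ^ (2 * nat \<bar>n\<bar> + 2) / (of_int \<bar>n\<bar> + 1)" if "n = m"
  proof -
    have s2: "s + 2 = real (2 * nat \<bar>n\<bar> + 2)" using that by (simp add: s_def)
    have "R powr (s + 2) = R ^ (2 * nat \<bar>n\<bar> + 2)"
    proof (cases "R = 0")
      case False
      then show ?thesis using R unfolding s2 by (intro powr_realpow) simp
    qed simp
    moreover have "s + 2 = 2 * (of_int \<bar>n\<bar> + 1)" using that by (simp add: s_def)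
    moreover have "2 * x / (2 * y) = x / y" for x y :: real by simp
    ultimately show ?thesis by (simp only:)
  qed
  have "has_bochner_integral dA (\<lambda>z. indicator (cball 0 R) z *\<^sub>R quasihomogeneous (n - m) s z)
      (if n = m then of_real (R ^ (2 * nat \<bar>n\<bar> + 2) / (of_int \<bar>n\<bar> + 1)) else 0)"
    using has_bochner_integral_dA_quasihomogeneous[OF s R, of "n - m"] val by (auto split: if_splits)
  moreover have "AE z in dA. indicator (cball 0 R) z *\<^sub>R quasihomogeneous (n - m) s z
      = indicator (cball 0 R) z *\<^sub>R (harmonic_monomial n z * cnj (harmonic_monomial m z))"
    using AE_dA_nonzero by (rule AE_mp) (auto simp: eq)
  ultimately show ?thesis
    by (subst has_bochner_integral_cong_AE[symmetric])
      (auto intro!: borel_measurable_dA borel_measurable_scaleR borel_measurable_indicator borel_measurable_times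
        simp: cnj_harmonic_monomial)
qed

lemma has_bochner_integral_harmonic_sum:
  assumes R: "0 \<le> R" "R \<le> 1"
  shows "has_bochner_integral dA (\<lambda>z. indicator (cball 0 R) z * (norm (harmonic_sum a N z))\<^sup>2)
    (\<Sum>n\<in>{- int N..int N}. (norm (a n))\<^sup>2 * R ^ (2 * nat \<bar>n\<bar> + 2) / (of_int \<bar>n\<bar> + 1))"
proof -
  let ?J = "{- int N..int N}" and ?I = "\<lambda>z. indicator (cball 0 R) z :: real"
  let ?v = "\<lambda>n m. if n = m then of_real (R ^ (2 * nat \<bar>n\<bar> + 2) / (of_int \<bar>n\<bar> + 1)) else (0::complex)"
  have "has_bochner_integral dA
      (\<lambda>z. \<Sum>n\<in>?J. \<Sum>m\<in>?J. (a n * cnj (a m)) * (?I z *\<^sub>R (harmonic_monomial n z * cnj (harmonic_monomial m z))))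
      (\<Sum>n\<in>?J. \<Sum>m\<in>?J. (a n * cnj (a m)) * ?v n m)"
    by (intro has_bochner_integral_sum has_bochner_integral_mult_right
        has_bochner_integral_harmonic_monomials[OF R])
  moreover have "(\<Sum>n\<in>?J. \<Sum>m\<in>?J. (a n * cnj (a m)) * (?I z *\<^sub>R (harmonic_monomial n z * cnj (harmonic_monomial m z))))
      = of_real (?I z * (norm (harmonic_sum a N z))\<^sup>2)" for z
  proof -
    have "of_real ((norm (harmonic_sum a N z))\<^sup>2)
        = (\<Sum>n\<in>?J. \<Sum>m\<in>?J. (a n * harmonic_monomial n z) * cnj (a m * harmonic_monomial m z))"
      unfolding complex_norm_square harmonic_sum_def cnj_sum sum_product ..
    then show ?thesis
      by (simp add: scaleR_conv_of_real sum_distrib_left mult_ac)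
  qed
  moreover have "(\<Sum>n\<in>?J. \<Sum>m\<in>?J. (a n * cnj (a m)) * ?v n m)
      = of_real (\<Sum>n\<in>?J. (norm (a n))\<^sup>2 * R ^ (2 * nat \<bar>n\<bar> + 2) / (of_int \<bar>n\<bar> + 1))"
  proof -
    have "(\<Sum>m\<in>?J. (a n * cnj (a m)) * ?v n m) = of_real ((norm (a n))\<^sup>2 * R ^ (2 * nat \<bar>n\<bar> + 2) / (of_int \<bar>n\<bar> + 1))"
      if n: "n \<in> ?J" for n
    proof -
      have "(\<Sum>m\<in>?J. (a n * cnj (a m)) * ?v n m)
          = (\<Sum>m\<in>?J. if n = m then (a n * cnj (a n)) * of_real (R ^ (2 * nat \<bar>n\<bar> + 2) / (of_int \<bar>n\<bar> + 1)) else 0)"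
        by (intro sum.cong) auto
      also have "\<dots> = (a n * cnj (a n)) * of_real (R ^ (2 * nat \<bar>n\<bar> + 2) / (of_int \<bar>n\<bar> + 1))"
        using n by simp
      finally show ?thesis by (simp flip: complex_norm_square)
    qed
    then show ?thesis by simp
  qed
  ultimately have "has_bochner_integral dA (\<lambda>z. complex_of_real (?I z * (norm (harmonic_sum a N z))\<^sup>2))
      (of_real (\<Sum>n\<in>?J. (norm (a n))\<^sup>2 * R ^ (2 * nat \<bar>n\<bar> + 2) / (of_int \<bar>n\<bar> + 1)))"
    by (simp only:)
  from has_bochner_integral_bounded_linear[OF bounded_linear_Re this]
  show ?thesis by (simp only: Re_complex_of_real)
qed

lemma norm_harmonic_sum_le:
  assumes r: "norm z \<le> r" and S: "summable (\<lambda>n. (norm (a (int n)) + norm (a (- int n))) * r ^ n)"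
  shows "norm (harmonic_sum a N z) \<le> (\<Sum>n. (norm (a (int n)) + norm (a (- int n))) * r ^ n)"
proof -
  have r0: "0 \<le> r" using r norm_ge_zero[of z] by linarith
  let ?g = "\<lambda>n. norm (a n * harmonic_monomial n z)"
  have "norm (harmonic_sum a N z) \<le> sum ?g {- int N..int N}"
    unfolding harmonic_sum_def by (rule norm_sum)
  also have "\<dots> \<le> (\<Sum>j\<le>N. ?g (int j)) + (\<Sum>j\<le>N. ?g (- int j))"
    unfolding sum_symmetric_interval by simp
  also have "\<dots> = (\<Sum>j\<le>N. (norm (a (int j)) + norm (a (- int j))) * norm z ^ j)"
    by (simp add: norm_mult norm_harmonic_monomial sum.distrib distrib_right)
  also have "\<dots> \<le> (\<Sum>j\<le>N. (norm (a (int j)) + norm (a (- int j))) * r ^ j)"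
    using r by (intro sum_mono mult_left_mono power_mono) auto
  also have "\<dots> \<le> (\<Sum>n. (norm (a (int n)) + norm (a (- int n))) * r ^ n)"
    using r0 by (intro sum_le_suminf S) auto
  finally show ?thesis .
qed

lemma borel_measurable_has_harmonic_series:
  assumes "has_harmonic_series f a"
  shows "f \<in> borel_measurable dA"
proof (rule borel_measurable_LIMSEQ_metric)
  show "harmonic_sum a N \<in> borel_measurable dA" for N
    by (intro borel_measurable_dA borel_measurable_harmonic_sum)
  show "(\<lambda>N. harmonic_sum a N z) \<longlonglongrightarrow> f z" if "z \<in> space dA" for z
    using assms that by (simp add: has_harmonic_series_def)
qed

lemma parseval_cball:
  assumes f: "has_harmonic_series f a" and R: "0 \<le> R" "R < 1"
  shows "integrable dA (\<lambda>z. indicator (cball 0 R) z * (norm (f z))\<^sup>2)"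
    and "(\<lambda>N. \<Sum>n\<in>{- int N..int N}. (norm (a n))\<^sup>2 * R ^ (2 * nat \<bar>n\<bar> + 2) / (of_int \<bar>n\<bar> + 1))
      \<longlonglongrightarrow> (LINT z|dA. indicator (cball 0 R) z * (norm (f z))\<^sup>2)"
proof -
  define M where "M = (\<Sum>n. (norm (a (int n)) + norm (a (- int n))) * R ^ n)"
  have sM: "summable (\<lambda>n. (norm (a (int n)) + norm (a (- int n))) * R ^ n)"
    using f R by (simp add: has_harmonic_series_def)
  let ?F = "\<lambda>N z. indicator (cball 0 R) z * (norm (harmonic_sum a N z))\<^sup>2"
  let ?f = "\<lambda>z. indicator (cball 0 R) z * (norm (f z))\<^sup>2"
  have h: "has_bochner_integral dA (?F N)
      (\<Sum>n\<in>{- int N..int N}. (norm (a n))\<^sup>2 * R ^ (2 * nat \<bar>n\<bar> + 2) / (of_int \<bar>n\<bar> + 1))" for N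
    using R by (intro has_bochner_integral_harmonic_sum) auto
  have mi: "indicator (cball 0 R) \<in> borel_measurable dA"
    by (intro borel_measurable_dA borel_measurable_indicator) simp
  have mf: "?f \<in> borel_measurable dA"
    using borel_measurable_has_harmonic_series[OF f] mi by measurable
  have mF: "?F N \<in> borel_measurable dA" for N
    using h[of N] by (simp add: has_bochner_integral_iff borel_measurable_integrable)
  \<comment> \<open>The factor \<open>norm z powr 0\<close>, which is \<open>1\<close> off the origin, brings the dominating constant into
    the form of the radial integral above.\<close>
  have dom: "integrable dA (\<lambda>z. indicator (cball 0 R) z *\<^sub>R (norm z powr 0 * M\<^sup>2))"
  proof -
    have "integrable dA (\<lambda>z. M\<^sup>2 * (indicator (cball 0 R) z *\<^sub>R (norm z powr 0)))"
      using has_bochner_integral_dA_powr[of 0 R] R by (simp add: has_bochner_integral_iff)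
    then show ?thesis by (simp add: mult_ac)
  qed
  have lim: "AE z in dA. (\<lambda>N. ?F N z) \<longlonglongrightarrow> ?f z"
    using f by (intro AE_I2 tendsto_intros) (auto simp: has_harmonic_series_def)
  have bnd: "AE z in dA. norm (?F N z) \<le> indicator (cball 0 R) z *\<^sub>R (norm z powr 0 * M\<^sup>2)" for N
    using AE_dA_nonzero
  proof (rule AE_mp, intro AE_I2 impI)
    fix z :: complex assume z: "z \<noteq> 0"
    show "norm (?F N z) \<le> indicator (cball 0 R) z *\<^sub>R (norm z powr 0 * M\<^sup>2)"
    proof (cases "norm z \<le> R")
      case True
      then have "(norm (harmonic_sum a N z))\<^sup>2 \<le> M\<^sup>2"
        unfolding M_def by (intro power_mono norm_harmonic_sum_le sM) auto
      then show ?thesis using True z by simp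
    qed simp
  qed
  show "integrable dA ?f"
    by (rule integrable_dominated_convergence[OF mf mF dom lim bnd])
  have "(\<lambda>N. integral\<^sup>L dA (?F N)) \<longlonglongrightarrow> integral\<^sup>L dA ?f"
    by (rule integral_dominated_convergence[OF mf mF dom lim bnd])
  then show "(\<lambda>N. \<Sum>n\<in>{- int N..int N}. (norm (a n))\<^sup>2 * R ^ (2 * nat \<bar>n\<bar> + 2) / (of_int \<bar>n\<bar> + 1))
      \<longlonglongrightarrow> (LINT z|dA. indicator (cball 0 R) z * (norm (f z))\<^sup>2)"
    using h by (simp add: has_bochner_integral_iff)
qed

text \<open>The squared norm of the partial sum of a harmonic series, as \<open>\<parallel>e\<^sub>n\<parallel>\<^sup>2 = 1 / (\<bar>n\<bar> + 1)\<close>.\<close>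

definition energy :: "(int \<Rightarrow> complex) \<Rightarrow> nat \<Rightarrow> real" where
  "energy a N = (\<Sum>n\<in>{- int N..int N}. (norm (a n))\<^sup>2 / (of_int \<bar>n\<bar> + 1))"

text \<open>On the disk of radius \<open>R < 1\<close> the Parseval identity bounds each partial sum by the integral
of \<open>\<bar>f\<bar>\<^sup>2\<close>; then \<open>R\<close> tends to \<open>1\<close> in a finite sum.\<close>

lemma energy_le_integral:
  assumes f: "has_harmonic_series f a" and int: "integrable dA (\<lambda>z. (norm (f z))\<^sup>2)"
  shows "energy a N \<le> (LINT z|dA. (norm (f z))\<^sup>2)"
proof (rule LIMSEQ_le_const2)
  let ?E = "\<lambda>R N. \<Sum>n\<in>{- int N..int N}. (norm (a n))\<^sup>2 * R ^ (2 * nat \<bar>n\<bar> + 2) / (of_int \<bar>n\<bar> + 1)"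
  let ?R = "\<lambda>j. real j / real (Suc j)"
  have "?R \<longlonglongrightarrow> 1" by (rule LIMSEQ_n_over_Suc_n)
  then have "(\<lambda>j. ?E (?R j) N) \<longlonglongrightarrow> ?E 1 N"
    by (intro tendsto_intros) auto
  then show "(\<lambda>j. ?E (?R j) N) \<longlonglongrightarrow> energy a N"
    by (simp add: energy_def)
  have "?E (?R j) N \<le> (LINT z|dA. (norm (f z))\<^sup>2)" for j
  proof -
    have R: "0 \<le> ?R j" "?R j < 1" by auto
    have "incseq (?E (?R j))"
      using R(1) by (intro incseq_SucI sum_mono2) auto
    then have "?E (?R j) N \<le> (LINT z|dA. indicator (cball 0 (?R j)) z * (norm (f z))\<^sup>2)"
      by (rule incseq_le[OF _ parseval_cball(2)[OF f R]])
    also have "\<dots> \<le> (LINT z|dA. (norm (f z))\<^sup>2)"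
      by (intro integral_mono parseval_cball(1)[OF f R] int) (auto simp: indicator_def)
    finally show ?thesis .
  qed
  then show "\<exists>N0. \<forall>j\<ge>N0. ?E (?R j) N \<le> (LINT z|dA. (norm (f z))\<^sup>2)" by blast
qed

text \<open>Monotone convergence along \<open>R = j / (j + 1)\<close>: the integrals over the smaller disks exist and are
bounded by \<open>K\<close>, and this yields square integrability on the whole disk.\<close>

lemma integral_le_of_energy_le:
  assumes f: "has_harmonic_series f a" and K: "\<And>N. energy a N \<le> K"
  shows "integrable dA (\<lambda>z. (norm (f z))\<^sup>2)" "(LINT z|dA. (norm (f z))\<^sup>2) \<le> K"
proof -
  let ?E = "\<lambda>R N. \<Sum>n\<in>{- int N..int N}. (norm (a n))\<^sup>2 * R ^ (2 * nat \<bar>n\<bar> + 2) / (of_int \<bar>n\<bar> + 1)"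
  let ?R = "\<lambda>j. real j / real (Suc j)"
  let ?F = "\<lambda>j z. indicator (cball 0 (?R j)) z * (norm (f z))\<^sup>2"
  have R: "0 \<le> ?R j" "?R j < 1" for j by auto
  have lim: "?R \<longlonglongrightarrow> 1" by (rule LIMSEQ_n_over_Suc_n)
  have mono_R: "?R i \<le> ?R j" if "i \<le> j" for i j
    using that by (simp add: divide_simps algebra_simps)
  have int: "integrable dA (?F j)" for j by (rule parseval_cball(1)[OF f R])
  have le: "integral\<^sup>L dA (?F j) \<le> K" for j
  proof (rule LIMSEQ_le_const2[OF parseval_cball(2)[OF f R]], intro exI allI impI)
    fix N
    have "?E (?R j) N \<le> energy a N"
      unfolding energy_def
    proof (rule sum_mono)
      fix n
      have "?R j ^ (2 * nat \<bar>n\<bar> + 2) \<le> 1" using R[of j] by (intro power_le_one) auto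
      then show "(norm (a n))\<^sup>2 * ?R j ^ (2 * nat \<bar>n\<bar> + 2) / (of_int \<bar>n\<bar> + 1) \<le> (norm (a n))\<^sup>2 / (of_int \<bar>n\<bar> + 1)"
        by (intro divide_right_mono mult_left_le) auto
    qed
    then show "?E (?R j) N \<le> K" using K[of N] by linarith
  qed
  have mono_F: "?F i z \<le> ?F j z" if "i \<le> j" for i j z
    using mono_R[OF that] by (auto simp: indicator_def)
  have "incseq (\<lambda>j. integral\<^sup>L dA (?F j))"
    unfolding incseq_def by (intro allI impI integral_mono int mono_F)
  then obtain L where L: "(\<lambda>j. integral\<^sup>L dA (?F j)) \<longlonglongrightarrow> L"
    by (rule incseq_convergent) (use le in blast)
  have ptw: "(\<lambda>j. ?F j z) \<longlonglongrightarrow> (norm (f z))\<^sup>2" if z: "z \<in> space dA" for z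
  proof (rule tendsto_eventually)
    have "norm z < 1" using z by simp
    with lim have "\<forall>\<^sub>F j in sequentially. norm z < ?R j" by (rule order_tendstoD)
    then show "\<forall>\<^sub>F j in sequentially. ?F j z = (norm (f z))\<^sup>2"
      by eventually_elim simp
  qed
  have mf: "(\<lambda>z. (norm (f z))\<^sup>2) \<in> borel_measurable dA"
    using borel_measurable_has_harmonic_series[OF f] by measurable
  have 1: "AE z in dA. mono (\<lambda>j. ?F j z)" by (intro AE_I2 monoI mono_F)
  have 2: "AE z in dA. 0 \<le> ?F j z" for j by (intro AE_I2) auto
  have 3: "AE z in dA. (\<lambda>j. ?F j z) \<longlonglongrightarrow> (norm (f z))\<^sup>2" by (intro AE_I2 ptw)
  show "integrable dA (\<lambda>z. (norm (f z))\<^sup>2)"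
    by (rule integral_monotone_convergence_nonneg(1)[OF int 1 2 3 L mf])
  have "(LINT z|dA. (norm (f z))\<^sup>2) = L"
    by (rule integral_monotone_convergence_nonneg(2)[OF int 1 2 3 L mf])
  also have "L \<le> K" by (rule LIMSEQ_le_const2[OF L]) (use le in blast)
  finally show "(LINT z|dA. (norm (f z))\<^sup>2) \<le> K" .
qed

section \<open>Coefficients of elements of the harmonic Bergman space\<close>

lemma energy_mono: "N \<le> M \<Longrightarrow> energy a N \<le> energy a M"
  unfolding energy_def by (rule sum_mono2) auto

lemma norm_coeff_le_energy:
  assumes "\<bar>n\<bar> \<le> int N"
  shows "(norm (a n))\<^sup>2 / (of_int \<bar>n\<bar> + 1) \<le> energy a N"
  unfolding energy_def
  by (rule member_le_sum[where f = "\<lambda>n. (norm (a n))\<^sup>2 / (of_int \<bar>n\<bar> + 1)"]) (use assms in auto)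

lemma has_harmonic_series_unique:
  assumes "has_harmonic_series f a" "has_harmonic_series f b"
  shows "a = b"
proof
  fix n
  have "has_harmonic_series (\<lambda>z. 0) (\<lambda>n. a n - b n)"
    using has_harmonic_series_linear[OF assms, of "-1"] by simp
  from energy_le_integral[OF this] have "energy (\<lambda>n. a n - b n) (nat \<bar>n\<bar>) \<le> 0" by simp
  moreover have "(norm (a n - b n))\<^sup>2 / (of_int \<bar>n\<bar> + 1) \<le> energy (\<lambda>n. a n - b n) (nat \<bar>n\<bar>)"
    by (rule norm_coeff_le_energy) simp
  ultimately have "(norm (a n - b n))\<^sup>2 / (of_int \<bar>n\<bar> + 1) \<le> 0" by linarith
  moreover have "0 < real_of_int \<bar>n\<bar> + 1" by linarith
  ultimately have "(norm (a n - b n))\<^sup>2 \<le> 0"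
    by (simp only: pos_divide_le_eq mult_zero_left)
  then show "a n = b n" by simp
qed

definition lh2_coeff :: "lh2 \<Rightarrow> int \<Rightarrow> complex" where
  "lh2_coeff h = (THE a. has_harmonic_series (lh2_fun h) a)"

lemma lh2_fun_harmonic: "harmonic_on unit_disk (lh2_fun h)"
  and lh2_fun_integrable: "integrable dA (\<lambda>z. (norm (lh2_fun h z))\<^sup>2)"
  and lh2_fun_outside: "z \<notin> unit_disk \<Longrightarrow> lh2_fun h z = 0"
  using lh2_fun[of h] by (auto dest: harmonic_bergmanD)

lemma lh2_coeff_eqI:
  assumes "has_harmonic_series (lh2_fun h) a"
  shows "lh2_coeff h = a"
  unfolding lh2_coeff_def using assms has_harmonic_series_unique by blast

lemma has_harmonic_series_lh2_coeff: "has_harmonic_series (lh2_fun h) (lh2_coeff h)"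
  using harmonic_on_imp_has_harmonic_series[OF lh2_fun_harmonic, of h] lh2_coeff_eqI by metis

lemma lh2_eqI:
  assumes "\<And>z. z \<in> unit_disk \<Longrightarrow> lh2_fun g z = lh2_fun h z"
  shows "g = h"
proof -
  have "lh2_fun g = lh2_fun h"
    using assms lh2_fun_outside by (metis ext)
  then show ?thesis by (simp add: lh2_fun_inject)
qed

lemma lh2_coeff_inject:
  assumes "lh2_coeff g = lh2_coeff h"
  shows "g = h"
proof (rule lh2_eqI)
  fix z assume "z \<in> unit_disk"
  then show "lh2_fun g z = lh2_fun h z"
    using has_harmonic_series_lh2_coeff[of g] has_harmonic_series_lh2_coeff[of h] assms
    unfolding has_harmonic_series_def by (metis LIMSEQ_unique)
qed

lemma norm_lh2_squared: "(norm h)\<^sup>2 = (LINT z|dA. (norm (lh2_fun h z))\<^sup>2)"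
  by (simp add: power2_norm_eq_inner[of h] inner_lh2.rep_eq power2_norm_eq_inner)

lemma energy_lh2_le: "energy (lh2_coeff h) N \<le> (norm h)\<^sup>2"
  unfolding norm_lh2_squared
  by (intro energy_le_integral has_harmonic_series_lh2_coeff lh2_fun_integrable)

lemma norm_lh2_le_energy:
  assumes "\<And>N. energy (lh2_coeff h) N \<le> K"
  shows "(norm h)\<^sup>2 \<le> K"
  unfolding norm_lh2_squared
  by (rule integral_le_of_energy_le[OF has_harmonic_series_lh2_coeff assms])

lemma has_harmonic_series_cong:
  assumes "has_harmonic_series f a" "\<And>z. z \<in> unit_disk \<Longrightarrow> g z = f z"
  shows "has_harmonic_series g a"
  using assms by (simp add: has_harmonic_series_def)

lemma harmonic_on_cong_open:
  assumes "open S" "harmonic_on S f" "\<And>z. z \<in> S \<Longrightarrow> g z = f z"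
  shows "harmonic_on S g"
proof -
  obtain f' f'' where f:
    "\<And>z. z \<in> S \<Longrightarrow> (f has_derivative blinfun_apply (f' z)) (at z)"
    "\<And>z. z \<in> S \<Longrightarrow> (f' has_derivative blinfun_apply (f'' z)) (at z)" "continuous_on S f''"
    "\<And>z. z \<in> S \<Longrightarrow> blinfun_apply (blinfun_apply (f'' z) 1) 1
              + blinfun_apply (blinfun_apply (f'' z) \<i>) \<i> = 0"
    using assms(2) unfolding harmonic_on_def by blast
  moreover have "(g has_derivative blinfun_apply (f' z)) (at z)" if "z \<in> S" for z
    by (rule has_derivative_transform_within_open[OF f(1)[OF that] assms(1) that]) (simp add: assms(3))
  ultimately show ?thesis unfolding harmonic_on_def by blast
qed

text \<open>The Riesz-Fischer property, by which operators can be defined through their action on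
coefficients. Bounded energy forces \<open>\<bar>a\<^sub>n\<bar> = O(\<bar>n\<bar> + 1)\<close>, so the series converges on the disk.\<close>

lemma ex_lh2_coeff:
  assumes K: "\<And>N. energy a N \<le> K"
  obtains h where "lh2_coeff h = a"
proof -
  have bound: "norm (a n) \<le> (K + 1) * (real_of_int \<bar>n\<bar> + 1)" for n
  proof -
    have "(norm (a n))\<^sup>2 / (of_int \<bar>n\<bar> + 1) \<le> K"
      using norm_coeff_le_energy[of n "nat \<bar>n\<bar>" a] K[of "nat \<bar>n\<bar>"] by simp
    then have "(norm (a n))\<^sup>2 \<le> K * (real_of_int \<bar>n\<bar> + 1)"
      by (simp add: pos_divide_le_eq)
    moreover have "0 \<le> K" using K[of 0] by (rule order_trans[rotated]) (simp add: energy_def)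
    moreover have "K * (real_of_int \<bar>n\<bar> + 1) \<le> (K + 1)\<^sup>2 * (real_of_int \<bar>n\<bar> + 1)\<^sup>2"
    proof (rule mult_mono)
      show "K \<le> (K + 1)\<^sup>2"
        using self_le_power[of "K + 1" 2] \<open>0 \<le> K\<close> by simp
      show "real_of_int \<bar>n\<bar> + 1 \<le> (real_of_int \<bar>n\<bar> + 1)\<^sup>2"
        by (rule self_le_power) auto
    qed auto
    ultimately have "(norm (a n))\<^sup>2 \<le> ((K + 1) * (real_of_int \<bar>n\<bar> + 1))\<^sup>2"
      by (simp add: power_mult_distrib)
    then show ?thesis by (rule power2_le_imp_le) (use \<open>0 \<le> K\<close> in simp)
  qed
  have summ: "summable (\<lambda>n. (norm (a (int n)) + norm (a (- int n))) * r ^ n)" if r: "0 \<le> r" "r < 1" for r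
  proof (rule summable_comparison_test'[where N = 0])
    have "summable (\<lambda>n. of_nat (Suc n) * r ^ n)"
      using geometric_deriv_sums[of r] r by (simp add: sums_iff)
    then show "summable (\<lambda>n. 2 * (K + 1) * (of_nat (Suc n) * r ^ n))"
      by (rule summable_mult)
    fix n
    have "(norm (a (int n)) + norm (a (- int n))) * r ^ n \<le> (2 * (K + 1) * real (Suc n)) * r ^ n"
      using r bound[of "int n"] bound[of "- int n"] by (intro mult_right_mono) (auto simp: algebra_simps)
    then show "norm ((norm (a (int n)) + norm (a (- int n))) * r ^ n) \<le> 2 * (K + 1) * (of_nat (Suc n) * r ^ n)"
      using r by (simp add: abs_mult mult.assoc)
  qed
  then obtain f where f: "harmonic_on unit_disk f" "has_harmonic_series f a"
    by (rule ex_harmonic_has_harmonic_series)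
  define g where "g z = (if z \<in> unit_disk then f z else 0)" for z
  have g: "harmonic_on unit_disk g" "has_harmonic_series g a"
    using f by (auto intro: harmonic_on_cong_open[OF open_ball f(1)] has_harmonic_series_cong[OF f(2)] simp: g_def)
  moreover have "integrable dA (\<lambda>z. (norm (g z))\<^sup>2)"
    by (rule integral_le_of_energy_le[OF g(2) K])
  ultimately have "g \<in> harmonic_bergman"
    by (simp add: harmonic_bergman_def g_def)
  then have "lh2_fun (Abs_lh2 g) = g" by (rule Abs_lh2_inverse)
  then have "lh2_coeff (Abs_lh2 g) = a"
    using g(2) by (intro lh2_coeff_eqI) simp
  then show ?thesis by (rule that)
qed

lemma lh2_coeff_linear: "lh2_coeff (g + scaleC_lh2 c h) n = lh2_coeff g n + c * lh2_coeff h n"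
proof -
  have "has_harmonic_series (lh2_fun (g + scaleC_lh2 c h)) (\<lambda>n. lh2_coeff g n + c * lh2_coeff h n)"
    using has_harmonic_series_linear[OF has_harmonic_series_lh2_coeff has_harmonic_series_lh2_coeff]
    by (simp add: plus_lh2.rep_eq scaleC_lh2.rep_eq)
  then show ?thesis by (simp add: lh2_coeff_eqI)
qed

lemma scaleR_lh2_eq_scaleC: "r *\<^sub>R h = scaleC_lh2 (of_real r) h" for h :: lh2
  by transfer (simp add: scaleR_conv_of_real)

lemma lh2_coeff_add: "lh2_coeff (g + h) n = lh2_coeff g n + lh2_coeff h n"
  using lh2_coeff_linear[of g 1 h] by simp

lemma lh2_coeff_zero [simp]: "lh2_coeff 0 n = 0"
  using lh2_coeff_add[of 0 0 n] by simp

lemma lh2_coeff_scaleC: "lh2_coeff (scaleC_lh2 c h) n = c * lh2_coeff h n"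
  using lh2_coeff_linear[of 0 c h] by simp

lemma lh2_coeff_scaleR: "lh2_coeff (r *\<^sub>R h) n = of_real r * lh2_coeff h n"
  by (simp add: scaleR_lh2_eq_scaleC lh2_coeff_scaleC)

lemma lh2_coeff_diff: "lh2_coeff (g - h) n = lh2_coeff g n - lh2_coeff h n"
  using lh2_coeff_add[of "g - h" h n] by simp

lemma lh2_coeff_sum: "lh2_coeff (sum f A) n = (\<Sum>i\<in>A. lh2_coeff (f i) n)"
  by (induction A rule: infinite_finite_induct) (simp_all add: lh2_coeff_add)

lemma norm_lh2_coeff_le: "norm (lh2_coeff h n) \<le> sqrt (of_int \<bar>n\<bar> + 1) * norm h"
proof -
  have "(norm (lh2_coeff h n))\<^sup>2 / (of_int \<bar>n\<bar> + 1) \<le> (norm h)\<^sup>2"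
    using norm_coeff_le_energy[of n "nat \<bar>n\<bar>" "lh2_coeff h"] energy_lh2_le[of h "nat \<bar>n\<bar>"] by simp
  then have "(norm (lh2_coeff h n))\<^sup>2 \<le> (sqrt (of_int \<bar>n\<bar> + 1) * norm h)\<^sup>2"
    by (simp add: pos_divide_le_eq power_mult_distrib mult.commute)
  then show ?thesis by (rule power2_le_imp_le) simp
qed

lemma continuous_on_lh2_coeff: "continuous_on UNIV (\<lambda>h. lh2_coeff h n)"
proof -
  have "bounded_linear (\<lambda>h. lh2_coeff h n)"
  proof (rule bounded_linear_intro[where K = "sqrt (of_int \<bar>n\<bar> + 1)"])
    show "norm (lh2_coeff h n) \<le> norm h * sqrt (of_int \<bar>n\<bar> + 1)" for h
      using norm_lh2_coeff_le[of h n] by (simp only: mult.commute)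
  qed (auto simp: lh2_coeff_add lh2_coeff_scaleR scaleR_conv_of_real)
  then show ?thesis by (rule linear_continuous_on)
qed

definition lh2_monomial :: "int \<Rightarrow> lh2" where
  "lh2_monomial n = Abs_lh2 (\<lambda>z. if z \<in> unit_disk then harmonic_monomial n z else 0)"

lemma harmonic_on_harmonic_monomial: "harmonic_on unit_disk (harmonic_monomial n)"
proof (cases "n \<ge> 0")
  case True
  have "harmonic_on unit_disk (\<lambda>z. z ^ nat n)"
    by (intro harmonic_on_holomorphic holomorphic_intros) auto
  then show ?thesis using True by (simp add: harmonic_monomial_def[abs_def])
next
  case False
  have "harmonic_on unit_disk (\<lambda>z. cnj (z ^ nat (- n)))"
    by (intro harmonic_on_bounded_linear[OF _ bounded_linear_cnj] harmonic_on_holomorphic holomorphic_intros) auto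
  then show ?thesis using False by (simp add: harmonic_monomial_def[abs_def])
qed

lemma has_harmonic_series_monomial: "has_harmonic_series (harmonic_monomial n) (\<lambda>j. if j = n then 1 else 0)"
proof -
  let ?a = "\<lambda>j. if j = n then 1 else (0::complex)"
  have "harmonic_sum ?a (nat \<bar>n\<bar>) = harmonic_monomial n"
  proof
    fix z
    have "harmonic_sum ?a (nat \<bar>n\<bar>) z = (\<Sum>j\<in>{- int (nat \<bar>n\<bar>)..int (nat \<bar>n\<bar>)}. if j = n then harmonic_monomial j z else 0)"
      unfolding harmonic_sum_def by (intro sum.cong) auto
    also have "\<dots> = harmonic_monomial n z" by (subst sum.delta) auto
    finally show "harmonic_sum ?a (nat \<bar>n\<bar>) z = harmonic_monomial n z" .
  qed
  moreover have "(\<lambda>j. if \<bar>j\<bar> \<le> int (nat \<bar>n\<bar>) then ?a j else 0) = ?a" by auto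
  ultimately show ?thesis using has_harmonic_series_finite_sum[of ?a "nat \<bar>n\<bar>"] by simp
qed

lemma lh2_fun_monomial:
  assumes "z \<in> unit_disk"
  shows "lh2_fun (lh2_monomial n) z = harmonic_monomial n z"
proof -
  let ?g = "\<lambda>z. if z \<in> unit_disk then harmonic_monomial n z else 0"
  have s: "has_harmonic_series ?g (\<lambda>j. if j = n then 1 else 0)"
    by (rule has_harmonic_series_cong[OF has_harmonic_series_monomial]) simp
  have "integrable dA (\<lambda>z. (norm (?g z))\<^sup>2)"
  proof (rule integral_le_of_energy_le[OF s])
    show "energy (\<lambda>j. if j = n then 1 else 0) N \<le> 1" for N
    proof -
      have "energy (\<lambda>j. if j = n then 1 else 0) N
          = (\<Sum>j\<in>{- int N..int N}. if j = n then 1 / (of_int \<bar>n\<bar> + 1) else 0)"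
        unfolding energy_def by (intro sum.cong) auto
      also have "\<dots> \<le> 1" by (subst sum.delta) (auto simp: divide_simps)
      finally show ?thesis .
    qed
  qed
  moreover have "harmonic_on unit_disk ?g"
    by (rule harmonic_on_cong_open[OF open_ball harmonic_on_harmonic_monomial]) simp
  ultimately have "?g \<in> harmonic_bergman" by (simp add: harmonic_bergman_def)
  then show ?thesis using assms by (simp add: lh2_monomial_def Abs_lh2_inverse)
qed

lemma lh2_coeff_monomial: "lh2_coeff (lh2_monomial n) j = (if j = n then 1 else 0)"
  using lh2_coeff_eqI[OF has_harmonic_series_cong[OF has_harmonic_series_monomial lh2_fun_monomial]]
  by simp

lemma lh2_fun_sum: "lh2_fun (sum f A) z = (\<Sum>i\<in>A. lh2_fun (f i) z)"
  by (induction A rule: infinite_finite_induct) (simp_all add: zero_lh2.rep_eq plus_lh2.rep_eq)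

definition lh2_partial_sum :: "lh2 \<Rightarrow> nat \<Rightarrow> lh2" where
  "lh2_partial_sum h N = (\<Sum>n\<in>{- int N..int N}. scaleC_lh2 (lh2_coeff h n) (lh2_monomial n))"

lemma lh2_coeff_partial_sum:
  "lh2_coeff (lh2_partial_sum h N) j = (if \<bar>j\<bar> \<le> int N then lh2_coeff h j else 0)"
proof -
  have "lh2_coeff (lh2_partial_sum h N) j
      = (\<Sum>n\<in>{- int N..int N}. if j = n then lh2_coeff h n else 0)"
    unfolding lh2_partial_sum_def lh2_coeff_sum
    by (intro sum.cong) (auto simp: lh2_coeff_scaleC lh2_coeff_monomial)
  also have "\<dots> = (if \<bar>j\<bar> \<le> int N then lh2_coeff h j else 0)"
    by (subst sum.delta') auto
  finally show ?thesis .
qed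

lemma lh2_fun_partial_sum:
  assumes "z \<in> unit_disk"
  shows "lh2_fun (lh2_partial_sum h N) z = harmonic_sum (lh2_coeff h) N z"
  using assms unfolding lh2_partial_sum_def harmonic_sum_def
  by (simp add: lh2_fun_sum scaleC_lh2.rep_eq lh2_fun_monomial)

text \<open>The difference \<open>h - S\<^sub>N h\<close> has the coefficients of \<open>h\<close> with \<open>\<bar>n\<bar> > N\<close>, so its squared norm is
at most the tail \<open>L - E\<^sub>N\<close> of the convergent increasing sequence of energies.\<close>

lemma lh2_partial_sum_tendsto: "(\<lambda>N. lh2_partial_sum h N) \<longlonglongrightarrow> h"
proof -
  have "incseq (energy (lh2_coeff h))" by (auto simp: incseq_def energy_mono)
  then obtain L where L: "energy (lh2_coeff h) \<longlonglongrightarrow> L" "\<And>N. energy (lh2_coeff h) N \<le> L"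
    by (rule incseq_convergent[where B = "(norm h)\<^sup>2"]) (auto simp: energy_lh2_le)
  have le: "(norm (h - lh2_partial_sum h N))\<^sup>2 \<le> L - energy (lh2_coeff h) N" for N
  proof (rule norm_lh2_le_energy)
    fix M
    let ?b = "lh2_coeff (h - lh2_partial_sum h N)"
    have b: "?b j = (if \<bar>j\<bar> \<le> int N then 0 else lh2_coeff h j)" for j
      by (simp add: lh2_coeff_diff lh2_coeff_partial_sum)
    have "energy ?b M \<le> energy ?b (max M N)" by (rule energy_mono) simp
    also have "\<dots> = energy (lh2_coeff h) (max M N) - energy (lh2_coeff h) N"
    proof -
      let ?e = "\<lambda>j. (norm (lh2_coeff h j))\<^sup>2 / (of_int \<bar>j\<bar> + 1)"
      have "energy ?b (max M N) = (\<Sum>j\<in>{- int (max M N)..int (max M N)}. if \<bar>j\<bar> \<le> int N then 0 else ?e j)"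
        unfolding energy_def by (intro sum.cong) (auto simp: b)
      also have "\<dots> = (\<Sum>j\<in>{- int (max M N)..int (max M N)} - {- int N..int N}. ?e j)"
        by (rule sum.mono_neutral_cong_right) auto
      also have "\<dots> = energy (lh2_coeff h) (max M N) - energy (lh2_coeff h) N"
        unfolding energy_def by (rule sum_diff) auto
      finally show ?thesis .
    qed
    also have "\<dots> \<le> L - energy (lh2_coeff h) N" using L(2) by simp
    finally show "energy ?b M \<le> L - energy (lh2_coeff h) N" .
  qed
  have "(\<lambda>N. (norm (lh2_partial_sum h N - h))\<^sup>2) \<longlonglongrightarrow> 0"
  proof (rule tendsto_sandwich[OF _ _ tendsto_const])
    show "(\<lambda>N. L - energy (lh2_coeff h) N) \<longlonglongrightarrow> 0"
      using tendsto_diff[OF tendsto_const[of L] L(1)] by simp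
    show "\<forall>\<^sub>F N in sequentially. (norm (lh2_partial_sum h N - h))\<^sup>2 \<le> L - energy (lh2_coeff h) N"
      using le by (simp add: norm_minus_commute)
  qed simp
  then have "(\<lambda>N. norm (lh2_partial_sum h N - h)) \<longlonglongrightarrow> 0"
    using tendsto_real_sqrt[of _ 0] by fastforce
  then show ?thesis by (rule LIM_zero_cancel[OF tendsto_norm_zero_cancel])
qed

section \<open>Weighted shifts and harmonic polynomials\<close>

text \<open>The factor \<open>\<bar>k\<bar> + 1\<close> bounds the ratio of the weights \<open>(\<bar>n - k\<bar> + 1) / (\<bar>n\<bar> + 1)\<close> of the two
index positions.\<close>

lemma energy_shift_le:
  assumes w: "\<And>n. norm (w n) \<le> C"
  shows "energy (\<lambda>n. w (n - k) * a (n - k)) N \<le> C\<^sup>2 * (of_int \<bar>k\<bar> + 1) * energy a (N + nat \<bar>k\<bar>)"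
proof -
  let ?c = "C\<^sup>2 * (of_int \<bar>k\<bar> + 1) :: real"
  let ?e = "\<lambda>j. (norm (a j))\<^sup>2 / (of_int \<bar>j\<bar> + 1)"
  have c0: "0 \<le> ?c" by simp
  have "energy (\<lambda>n. w (n - k) * a (n - k)) N \<le> (\<Sum>n\<in>{- int N..int N}. ?c * ?e (n - k))"
    unfolding energy_def
  proof (rule sum_mono)
    fix n
    have "(norm (w (n - k) * a (n - k)))\<^sup>2 \<le> C\<^sup>2 * (norm (a (n - k)))\<^sup>2"
      unfolding norm_mult power_mult_distrib by (intro mult_right_mono power_mono w) auto
    moreover have "real_of_int \<bar>n - k\<bar> + 1 \<le> (of_int \<bar>k\<bar> + 1) * (of_int \<bar>n\<bar> + 1)"
    proof -
      have "\<bar>n - k\<bar> + 1 \<le> (\<bar>k\<bar> + 1) * (\<bar>n\<bar> + 1)"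
        using abs_triangle_ineq4[of n k] mult_nonneg_nonneg[of "\<bar>k\<bar>" "\<bar>n\<bar>"]
        unfolding distrib_left distrib_right by linarith
      then have "real_of_int (\<bar>n - k\<bar> + 1) \<le> of_int ((\<bar>k\<bar> + 1) * (\<bar>n\<bar> + 1))"
        by (simp only: of_int_le_iff)
      then show ?thesis by simp
    qed
    ultimately have "(norm (w (n - k) * a (n - k)))\<^sup>2 * (real_of_int \<bar>n - k\<bar> + 1)
        \<le> (C\<^sup>2 * (norm (a (n - k)))\<^sup>2) * ((of_int \<bar>k\<bar> + 1) * (of_int \<bar>n\<bar> + 1))"
      by (intro mult_mono) auto
    then show "(norm (w (n - k) * a (n - k)))\<^sup>2 / (of_int \<bar>n\<bar> + 1) \<le> ?c * ?e (n - k)"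
      by (simp add: pos_divide_le_eq pos_le_divide_eq add_nonneg_pos mult_ac)
  qed
  also have "\<dots> = ?c * (\<Sum>n\<in>{- int N..int N}. ?e (n - k))"
    by (simp add: sum_distrib_left)
  also have "(\<Sum>n\<in>{- int N..int N}. ?e (n - k)) = (\<Sum>j\<in>{- int N - k..int N - k}. ?e j)"
    by (rule sum.reindex_bij_witness[where i = "\<lambda>j. j + k" and j = "\<lambda>n. n - k"]) auto
  also have "?c * \<dots> \<le> ?c * energy a (N + nat \<bar>k\<bar>)"
    unfolding energy_def by (intro mult_left_mono[OF sum_mono2 c0]) auto
  finally show ?thesis .
qed

lemma ex_weighted_shift:
  assumes w: "\<And>n. norm (w n) \<le> C"
  obtains T :: "lh2 \<Rightarrow>\<^sub>L lh2" where "\<And>h n. lh2_coeff (T h) n = w (n - k) * lh2_coeff h (n - k)"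
proof -
  let ?c = "C\<^sup>2 * (of_int \<bar>k\<bar> + 1) :: real"
  have c0: "0 \<le> ?c" by simp
  have le: "energy (\<lambda>n. w (n - k) * lh2_coeff h (n - k)) N \<le> ?c * (norm h)\<^sup>2" for h N
    using energy_shift_le[where w = w and a = "lh2_coeff h" and N = N and k = k, OF w]
      mult_left_mono[OF energy_lh2_le[of h "N + nat \<bar>k\<bar>"] c0] by linarith
  have "\<exists>g. lh2_coeff g = (\<lambda>n. w (n - k) * lh2_coeff h (n - k))" for h
    using ex_lh2_coeff[OF le[of h]] by metis
  then obtain S where S: "\<And>h. lh2_coeff (S h) = (\<lambda>n. w (n - k) * lh2_coeff h (n - k))"
    by metis
  have "bounded_linear S"
  proof (rule bounded_linear_intro[where K = "sqrt ?c"])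
    show "S (g + h) = S g + S h" for g h
      by (rule lh2_coeff_inject) (simp add: fun_eq_iff S lh2_coeff_add algebra_simps)
    show "S (r *\<^sub>R h) = r *\<^sub>R S h" for r h
      by (rule lh2_coeff_inject) (simp add: fun_eq_iff S lh2_coeff_scaleR)
    show "norm (S h) \<le> norm h * sqrt ?c" for h
    proof (rule power2_le_imp_le)
      have "(norm (S h))\<^sup>2 \<le> ?c * (norm h)\<^sup>2"
        using le[of h] by (intro norm_lh2_le_energy) (simp add: S)
      then show "(norm (S h))\<^sup>2 \<le> (norm h * sqrt ?c)\<^sup>2"
        using c0 by (simp only: power_mult_distrib real_sqrt_pow2 mult.commute)
    qed (rule mult_nonneg_nonneg[OF norm_ge_zero real_sqrt_ge_zero[OF c0]])
  qed
  then have "blinfun_apply (Blinfun S) = S" by (rule bounded_linear_Blinfun_apply)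
  then show ?thesis using that[of "Blinfun S"] S by simp
qed

lemma lh2_partial_sum_harmonic_polynomial: "lh2_partial_sum h N \<in> harmonic_polynomials"
proof -
  let ?a = "lh2_coeff h"
  let ?p = "\<lambda>i j :: nat. if j = 0 then ?a (int i) else if i = 0 then ?a (- int j) else 0"
  have "lh2_fun (lh2_partial_sum h N) z = (\<Sum>i\<le>N. \<Sum>j\<le>N. ?p i j * z ^ i * cnj z ^ j)"
    if z: "z \<in> unit_disk" for z
  proof -
    let ?r = "(\<Sum>j\<le>N. ?a (- int j) * cnj z ^ j) - ?a 0"
    have inner: "(\<Sum>j\<le>N. ?p i j * z ^ i * cnj z ^ j) = ?a (int i) * z ^ i + (if i = 0 then ?r else 0)" for i
    proof (cases "i = 0")
      case True
      have "(\<Sum>j\<le>N. ?p i j * z ^ i * cnj z ^ j) = (\<Sum>j\<le>N. ?a (- int j) * cnj z ^ j)"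
        using True by (intro sum.cong) auto
      then show ?thesis using True by simp
    next
      case False
      have "(\<Sum>j\<le>N. ?p i j * z ^ i * cnj z ^ j) = (\<Sum>j\<le>N. if j = 0 then ?a (int i) * z ^ i else 0)"
        using False by (intro sum.cong) auto
      then show ?thesis using False by simp
    qed
    have "lh2_fun (lh2_partial_sum h N) z
        = (\<Sum>i\<le>N. ?a (int i) * z ^ i) + (\<Sum>j\<le>N. ?a (- int j) * cnj z ^ j) - ?a 0"
      unfolding lh2_fun_partial_sum[OF z] harmonic_sum_def sum_symmetric_interval
      by (auto simp: harmonic_monomial_def intro!: arg_cong2[where f = "(+)"] sum.cong)
    also have "\<dots> = (\<Sum>i\<le>N. \<Sum>j\<le>N. ?p i j * z ^ i * cnj z ^ j)"
      unfolding inner by (simp add: sum.distrib)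
    finally show ?thesis .
  qed
  then have "\<forall>z\<in>unit_disk. lh2_fun (lh2_partial_sum h N) z = (\<Sum>i\<le>N. \<Sum>j\<le>N. ?p i j * z ^ i * cnj z ^ j)"
    by blast
  then show ?thesis
    unfolding harmonic_polynomials_def
    by (intro CollectI exI[of _ N] exI[of _ ?p])
qed

lemma blinfun_eq_on_harmonic_polynomials:
  fixes S T :: "lh2 \<Rightarrow>\<^sub>L lh2"
  assumes "\<And>h. h \<in> harmonic_polynomials \<Longrightarrow> S h = T h"
  shows "S = T"
proof (rule blinfun_eqI)
  fix h
  have "(\<lambda>N. S (lh2_partial_sum h N)) \<longlonglongrightarrow> S h" "(\<lambda>N. T (lh2_partial_sum h N)) \<longlonglongrightarrow> T h"
    by (intro blinfun.tendsto tendsto_const lh2_partial_sum_tendsto)+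
  then show "S h = T h"
    using LIMSEQ_unique by (simp add: assms lh2_partial_sum_harmonic_polynomial)
qed

lemma has_bochner_integral_dA_quasihomogeneous_disk:
  assumes "s > -2"
  shows "has_bochner_integral dA (quasihomogeneous k s) (if k = 0 then of_real (2 / (s + 2)) else 0)"
proof -
  have "has_bochner_integral dA (\<lambda>z. indicator (cball 0 1) z *\<^sub>R quasihomogeneous k s z)
      (if k = 0 then of_real (2 / (s + 2)) else 0)"
    using has_bochner_integral_dA_quasihomogeneous[OF assms, of 1 k]
    by (simp only: powr_one_eq_one mult_1_right zero_le_one order_refl)
  then show ?thesis
    by (rule has_bochner_integral_cong[THEN iffD1, rotated -1]) (auto simp: indicator_def)
qed

text \<open>Because \<open>inner\<close> is only the real part of the scalar product, the multiple \<open>c\<close> of the monomial is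
needed to recover the complex coefficient.\<close>

lemma inner_lh2_monomial:
  "inner h (scaleC_lh2 c (lh2_monomial n)) = Re (lh2_coeff h n * cnj c) / (of_int \<bar>n\<bar> + 1)"
proof -
  have basic: "inner (scaleC_lh2 a (lh2_monomial j)) (scaleC_lh2 c (lh2_monomial n))
      = (if j = n then Re (a * cnj c) / (of_int \<bar>n\<bar> + 1) else 0)" for a j
  proof -
    let ?v = "if j = n then of_real (1 / (of_int \<bar>j\<bar> + 1)) else (0::complex)"
    have "has_bochner_integral dA (\<lambda>z. indicator (cball 0 1) z *\<^sub>R (harmonic_monomial j z * cnj (harmonic_monomial n z))) ?v"
      using has_bochner_integral_harmonic_monomials[of 1 j n] by (simp only: power_one zero_le_one order_refl)
    then have "has_bochner_integral dA (\<lambda>z. (a * cnj c) * (indicator (cball 0 1) z *\<^sub>R (harmonic_monomial j z * cnj (harmonic_monomial n z)))) ((a * cnj c) * ?v)"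
      by (intro has_bochner_integral_mult_right)
    from has_bochner_integral_bounded_linear[OF bounded_linear_Re this]
    have "(LINT z|dA. Re ((a * cnj c) * (indicator (cball 0 1) z *\<^sub>R (harmonic_monomial j z * cnj (harmonic_monomial n z)))))
        = Re ((a * cnj c) * ?v)"
      by (rule has_bochner_integral_integral_eq)
    moreover have "(LINT z|dA. lh2_fun (scaleC_lh2 a (lh2_monomial j)) z \<bullet> lh2_fun (scaleC_lh2 c (lh2_monomial n)) z)
        = (LINT z|dA. Re ((a * cnj c) * (indicator (cball 0 1) z *\<^sub>R (harmonic_monomial j z * cnj (harmonic_monomial n z)))))"
    proof (rule Bochner_Integration.integral_cong[OF refl])
      fix z assume "z \<in> space dA"
      then have z: "z \<in> unit_disk" by simp
      have "x \<bullet> y = Re (x * cnj y)" for x y :: complex by (simp add: inner_complex_def)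
      then show "lh2_fun (scaleC_lh2 a (lh2_monomial j)) z \<bullet> lh2_fun (scaleC_lh2 c (lh2_monomial n)) z
          = Re ((a * cnj c) * (indicator (cball 0 1) z *\<^sub>R (harmonic_monomial j z * cnj (harmonic_monomial n z))))"
        using z by (simp add: scaleC_lh2.rep_eq lh2_fun_monomial algebra_simps)
    qed
    moreover have "Re ((a * cnj c) * ?v) = (if j = n then Re (a * cnj c) / (of_int \<bar>n\<bar> + 1) else 0)"
      by (simp add: Re_divide_of_real[symmetric] del: Re_divide_of_real)
    ultimately show ?thesis unfolding inner_lh2.rep_eq by simp
  qed
  have eq: "inner (lh2_partial_sum h N) (scaleC_lh2 c (lh2_monomial n)) = Re (lh2_coeff h n * cnj c) / (of_int \<bar>n\<bar> + 1)"
    if "N \<ge> nat \<bar>n\<bar>" for N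
  proof -
    have "inner (lh2_partial_sum h N) (scaleC_lh2 c (lh2_monomial n))
        = (\<Sum>j\<in>{- int N..int N}. if j = n then Re (lh2_coeff h j * cnj c) / (of_int \<bar>n\<bar> + 1) else 0)"
      unfolding lh2_partial_sum_def inner_sum_left basic ..
    also have "\<dots> = Re (lh2_coeff h n * cnj c) / (of_int \<bar>n\<bar> + 1)"
      using that by (subst sum.delta) auto
    finally show ?thesis .
  qed
  have "(\<lambda>N. inner (lh2_partial_sum h N) (scaleC_lh2 c (lh2_monomial n))) \<longlonglongrightarrow> inner h (scaleC_lh2 c (lh2_monomial n))"
    by (intro tendsto_inner tendsto_const lh2_partial_sum_tendsto)
  moreover have "(\<lambda>N. inner (lh2_partial_sum h N) (scaleC_lh2 c (lh2_monomial n)))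
      \<longlonglongrightarrow> Re (lh2_coeff h n * cnj c) / (of_int \<bar>n\<bar> + 1)"
    by (intro tendsto_eventually eventually_sequentiallyI[of "nat \<bar>n\<bar>"] eq)
  ultimately show ?thesis by (rule LIMSEQ_unique)
qed

text \<open>A polynomial in \<open>z\<close> and its conjugate may contain mixed terms. The term with exponents \<open>i\<close>
and \<open>j\<close> has angular frequency \<open>i - j\<close>, so a polynomial of degree at most \<open>N\<close> in each variable is
orthogonal to all \<open>e\<^sub>n\<close> with \<open>\<bar>n\<bar> > N\<close>, and if it is harmonic, its series is finite.\<close>

lemma harmonic_polynomial_eq_partial_sum:
  assumes "h \<in> harmonic_polynomials"
  obtains N where "lh2_partial_sum h N = h"
proof -
  obtain N :: nat and p :: "nat \<Rightarrow> nat \<Rightarrow> complex"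
    where p: "\<And>z. z \<in> unit_disk \<Longrightarrow> lh2_fun h z = (\<Sum>i\<le>N. \<Sum>j\<le>N. p i j * z ^ i * cnj z ^ j)"
    using assms unfolding harmonic_polynomials_def by blast
  have zero: "lh2_coeff h n = 0" if n: "\<bar>n\<bar> > int N" for n
  proof -
    define c where "c = lh2_coeff h n"
    let ?q = "\<lambda>i j z. (p i j * cnj c) * quasihomogeneous (int i - int j - n) (real i + real j + of_int \<bar>n\<bar>) z"
    have "has_bochner_integral dA (\<lambda>z. \<Sum>i\<le>N. \<Sum>j\<le>N. ?q i j z) (\<Sum>i\<le>N. \<Sum>j\<le>N. (p i j * cnj c) * 0)"
    proof (intro has_bochner_integral_sum has_bochner_integral_mult_right)
      fix i j assume "i \<in> {..N}" "j \<in> {..N}"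
      then have "int i - int j - n \<noteq> 0" using n by auto
      moreover have "real i + real j + of_int \<bar>n\<bar> > -2" by linarith
      ultimately show "has_bochner_integral dA (quasihomogeneous (int i - int j - n) (real i + real j + of_int \<bar>n\<bar>)) 0"
        using has_bochner_integral_dA_quasihomogeneous_disk by metis
    qed
    then have "has_bochner_integral dA (\<lambda>z. \<Sum>i\<le>N. \<Sum>j\<le>N. ?q i j z) 0" by simp
    from has_bochner_integral_bounded_linear[OF bounded_linear_Re this]
    have 0: "(LINT z|dA. Re (\<Sum>i\<le>N. \<Sum>j\<le>N. ?q i j z)) = 0"
      by (simp add: has_bochner_integral_iff)
    have "inner h (scaleC_lh2 c (lh2_monomial n)) = (LINT z|dA. lh2_fun h z \<bullet> lh2_fun (scaleC_lh2 c (lh2_monomial n)) z)"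
      by (simp add: inner_lh2.rep_eq)
    also have "\<dots> = (LINT z|dA. Re (\<Sum>i\<le>N. \<Sum>j\<le>N. ?q i j z))"
    proof (rule integral_cong_AE)
      show "(\<lambda>z. lh2_fun h z \<bullet> lh2_fun (scaleC_lh2 c (lh2_monomial n)) z) \<in> borel_measurable dA"
        by (intro borel_measurable_inner borel_measurable_has_harmonic_series[OF has_harmonic_series_lh2_coeff])
      show "(\<lambda>z. Re (\<Sum>i\<le>N. \<Sum>j\<le>N. ?q i j z)) \<in> borel_measurable dA"
        by (intro borel_measurable_dA) measurable
      show "AE z in dA. lh2_fun h z \<bullet> lh2_fun (scaleC_lh2 c (lh2_monomial n)) z = Re (\<Sum>i\<le>N. \<Sum>j\<le>N. ?q i j z)"
        using AE_dA_nonzero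
      proof (rule AE_mp, intro AE_I2 impI)
        fix z assume "z \<in> space dA" and nz: "z \<noteq> 0"
        then have z: "z \<in> unit_disk" by simp
        have q: "?q i j z = (p i j * z ^ i * cnj z ^ j) * cnj (c * harmonic_monomial n z)" for i j
        proof -
          have "quasihomogeneous (int i - int j - n) (real i + real j + of_int \<bar>n\<bar>) z
              = quasihomogeneous (int i) (real_of_int \<bar>int i\<bar>) z * quasihomogeneous (- int j) (real_of_int \<bar>- int j\<bar>) z
                * quasihomogeneous (- n) (real_of_int \<bar>- n\<bar>) z"
            by (simp add: quasihomogeneous_mult)
          also have "\<dots> = z ^ i * cnj z ^ j * cnj (harmonic_monomial n z)"
            unfolding quasihomogeneous_eq_harmonic_monomial[OF nz] cnj_harmonic_monomial
            by (simp add: harmonic_monomial_def)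
          finally show ?thesis by simp
        qed
        have "lh2_fun h z \<bullet> lh2_fun (scaleC_lh2 c (lh2_monomial n)) z = Re (lh2_fun h z * cnj (c * harmonic_monomial n z))"
          using z by (simp add: inner_complex_def scaleC_lh2.rep_eq lh2_fun_monomial algebra_simps)
        also have "lh2_fun h z * cnj (c * harmonic_monomial n z) = (\<Sum>i\<le>N. \<Sum>j\<le>N. ?q i j z)"
          unfolding p[OF z] sum_distrib_right q ..
        finally show "lh2_fun h z \<bullet> lh2_fun (scaleC_lh2 c (lh2_monomial n)) z = Re (\<Sum>i\<le>N. \<Sum>j\<le>N. ?q i j z)" .
      qed
    qed
    finally have "inner h (scaleC_lh2 c (lh2_monomial n)) = 0"
      using 0 by (rule trans)
    then have "Re (c * cnj c) / (real_of_int \<bar>n\<bar> + 1) = 0"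
      unfolding inner_lh2_monomial c_def .
    moreover have "real_of_int \<bar>n\<bar> + 1 \<noteq> 0" by linarith
    ultimately have "Re (c * cnj c) = 0" by simp
    then have "(norm c)\<^sup>2 = 0" unfolding complex_norm_square[symmetric] by simp
    then show ?thesis by (simp add: c_def)
  qed
  have "lh2_partial_sum h N = h"
    by (rule lh2_coeff_inject) (auto simp: fun_eq_iff lh2_coeff_partial_sum zero)
  then show ?thesis by (rule that)
qed

section \<open>Toeplitz operators with quasihomogeneous symbols\<close>

text \<open>The kernel of \<open>Q\<close> is \<open>\<Sum> (\<bar>n\<bar> + 1) e\<^sub>n(z)\<close> times the conjugate of \<open>e\<^sub>n(w)\<close>, the reproducing
kernel of the orthogonal basis; the summand \<open>- 1\<close> compensates for counting \<open>n = 0\<close> twice.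
The bound is uniform in \<open>w\<close>, which allows termwise integration.\<close>

lemma kernel_partial_sum:
  assumes zw: "norm z < 1" "norm w < 1"
  defines "K \<equiv> \<lambda>N. \<Sum>n\<in>{- int N..int N}. of_int (\<bar>n\<bar> + 1) * harmonic_monomial n z * cnj (harmonic_monomial n w)"
  shows "K \<longlonglongrightarrow> 1 / (1 - z * cnj w)\<^sup>2 + 1 / (1 - cnj z * w)\<^sup>2 - 1"
    and "norm (K N) \<le> 2 / (1 - norm z)\<^sup>2"
proof -
  have K: "K N = (\<Sum>j\<le>N. of_nat (Suc j) * (z * cnj w) ^ j) + (\<Sum>j\<le>N. of_nat (Suc j) * (cnj z * w) ^ j) - 1" for N
    unfolding K_def sum_symmetric_interval
    by (auto simp: harmonic_monomial_def power_mult_distrib mult_ac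
        intro!: arg_cong2[where f = "(+)"] sum.cong)
  have b: "norm (z * cnj w) < 1" "norm (cnj z * w) < 1"
    using mult_strict_mono[OF zw] by (simp_all add: norm_mult)
  show "K \<longlonglongrightarrow> 1 / (1 - z * cnj w)\<^sup>2 + 1 / (1 - cnj z * w)\<^sup>2 - 1"
    unfolding K using geometric_deriv_sums[OF b(1)] geometric_deriv_sums[OF b(2)]
    by (intro tendsto_intros) (simp_all add: sums_def_le)
  let ?g = "\<lambda>n. real_of_int (\<bar>n\<bar> + 1) * norm z ^ nat \<bar>n\<bar>"
  have sg: "(\<lambda>j. of_nat (Suc j) * norm z ^ j) sums (1 / (1 - norm z)\<^sup>2)"
    using geometric_deriv_sums[of "norm z"] zw by simp
  have le: "(\<Sum>j\<le>N. ?g (int j)) \<le> 1 / (1 - norm z)\<^sup>2" "(\<Sum>j\<le>N. ?g (- int j)) \<le> 1 / (1 - norm z)\<^sup>2"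
    using sum_le_suminf[OF sums_summable[OF sg], of "{..N}"] sums_unique[OF sg]
    by (simp_all add: add.commute)
  have "norm (K N) \<le> (\<Sum>n\<in>{- int N..int N}. ?g n)"
    unfolding K_def
  proof (rule sum_norm_le)
    fix n
    have "norm w ^ nat \<bar>n\<bar> \<le> 1" using zw by (intro power_le_one) auto
    then have "norm z ^ nat \<bar>n\<bar> * norm w ^ nat \<bar>n\<bar> \<le> norm z ^ nat \<bar>n\<bar>"
      by (intro mult_left_le) auto
    then have "real_of_int (\<bar>n\<bar> + 1) * (norm z ^ nat \<bar>n\<bar> * norm w ^ nat \<bar>n\<bar>) \<le> ?g n"
      by (intro mult_left_mono) auto
    then show "norm (of_int (\<bar>n\<bar> + 1) * harmonic_monomial n z * cnj (harmonic_monomial n w)) \<le> ?g n"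
      by (simp add: norm_mult norm_harmonic_monomial mult.assoc del: of_int_add)
  qed
  also have "\<dots> \<le> (\<Sum>j\<le>N. ?g (int j)) + (\<Sum>j\<le>N. ?g (- int j))"
    unfolding sum_symmetric_interval by simp
  also have "\<dots> \<le> 2 / (1 - norm z)\<^sup>2"
    using le by simp
  finally show "norm (K N) \<le> 2 / (1 - norm z)\<^sup>2" .
qed

text \<open>Termwise integration of the kernel against a function of angular frequency \<open>k\<close> leaves the term
with \<open>n = k\<close> alone.\<close>

lemma has_bochner_integral_kernel_quasihomogeneous:
  assumes z: "z \<in> unit_disk" and s: "s > -2"
  shows "has_bochner_integral dA
    (\<lambda>w. (1 / (1 - z * cnj w)\<^sup>2 + 1 / (1 - cnj z * w)\<^sup>2 - 1) * quasihomogeneous k s w)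
    (of_real (2 * (of_int \<bar>k\<bar> + 1) / (s + of_int \<bar>k\<bar> + 2)) * harmonic_monomial k z)"
proof -
  let ?u = "quasihomogeneous k s"
  let ?K = "\<lambda>N w. \<Sum>n\<in>{- int N..int N}. of_int (\<bar>n\<bar> + 1) * harmonic_monomial n z * cnj (harmonic_monomial n w)"
  let ?k = "\<lambda>w. 1 / (1 - z * cnj w)\<^sup>2 + 1 / (1 - cnj z * w)\<^sup>2 - 1"
  let ?val = "of_real (2 * (of_int \<bar>k\<bar> + 1) / (s + of_int \<bar>k\<bar> + 2)) * harmonic_monomial k z"
  let ?c = "2 / (1 - norm z)\<^sup>2"
  have nz: "norm z < 1" using z by simp
  have term_int: "has_bochner_integral dA (\<lambda>w. cnj (harmonic_monomial n w) * ?u w)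
      (if n = k then of_real (2 / (s + of_int \<bar>k\<bar> + 2)) else 0)" for n
  proof -
    have "s + of_int \<bar>n\<bar> > -2" using s by linarith
    then have "has_bochner_integral dA (quasihomogeneous (k - n) (s + of_int \<bar>n\<bar>))
        (if n = k then of_real (2 / (s + of_int \<bar>k\<bar> + 2)) else 0)"
      using has_bochner_integral_dA_quasihomogeneous_disk[of "s + of_int \<bar>n\<bar>" "k - n"] by (auto split: if_splits)
    moreover have "AE w in dA. quasihomogeneous (k - n) (s + of_int \<bar>n\<bar>) w = cnj (harmonic_monomial n w) * ?u w"
      using AE_dA_nonzero
    proof (rule AE_mp, intro AE_I2 impI)
      fix w :: complex assume w: "w \<noteq> 0"
      have "quasihomogeneous (k - n) (s + of_int \<bar>n\<bar>) w = quasihomogeneous (- n) (real_of_int \<bar>- n\<bar>) w * ?u w"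
        by (simp add: quasihomogeneous_mult add.commute)
      then show "quasihomogeneous (k - n) (s + of_int \<bar>n\<bar>) w = cnj (harmonic_monomial n w) * ?u w"
        unfolding quasihomogeneous_eq_harmonic_monomial[OF w] cnj_harmonic_monomial .
    qed
    ultimately show ?thesis
      by (subst has_bochner_integral_cong_AE[symmetric])
        (auto intro!: borel_measurable_dA borel_measurable_times simp: cnj_harmonic_monomial)
  qed
  have partial: "has_bochner_integral dA (\<lambda>w. ?K N w * ?u w) ?val" if N: "N \<ge> nat \<bar>k\<bar>" for N
  proof -
    have "has_bochner_integral dA
        (\<lambda>w. \<Sum>n\<in>{- int N..int N}. (of_int (\<bar>n\<bar> + 1) * harmonic_monomial n z) * (cnj (harmonic_monomial n w) * ?u w))
        (\<Sum>n\<in>{- int N..int N}. (of_int (\<bar>n\<bar> + 1) * harmonic_monomial n z)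
          * (if n = k then of_real (2 / (s + of_int \<bar>k\<bar> + 2)) else 0))"
      by (intro has_bochner_integral_sum has_bochner_integral_mult_right term_int)
    moreover have "(\<Sum>n\<in>{- int N..int N}. (of_int (\<bar>n\<bar> + 1) * harmonic_monomial n z)
          * (if n = k then of_real (2 / (s + of_int \<bar>k\<bar> + 2)) else 0)) = ?val"
    proof -
      have "(\<Sum>n\<in>{- int N..int N}. (of_int (\<bar>n\<bar> + 1) * harmonic_monomial n z)
          * (if n = k then of_real (2 / (s + of_int \<bar>k\<bar> + 2)) else 0))
        = (\<Sum>n\<in>{- int N..int N}. if n = k then ?val else 0)"
      proof -
        have "complex_of_real \<bar>real_of_int k\<bar> = of_int \<bar>k\<bar>"
          by (metis of_int_abs of_real_of_int_eq)
        then show ?thesis by (intro sum.cong) auto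
      qed
      also have "\<dots> = ?val" using N by (subst sum.delta) auto
      finally show ?thesis .
    qed
    ultimately show ?thesis by (simp add: sum_distrib_right mult.assoc)
  qed
  have lim: "AE w in dA. (\<lambda>N. ?K (N + nat \<bar>k\<bar>) w * ?u w) \<longlonglongrightarrow> ?k w * ?u w"
    by (intro AE_I2 tendsto_intros LIMSEQ_ignore_initial_segment[OF kernel_partial_sum(1)[OF nz]]) auto
  have mK: "(\<lambda>w. ?K (N + nat \<bar>k\<bar>) w * ?u w) \<in> borel_measurable dA" for N
    using partial[of "N + nat \<bar>k\<bar>"] by (simp add: has_bochner_integral_iff borel_measurable_integrable)
  have [measurable]: "cnj \<in> borel_measurable borel"
    by (intro borel_measurable_continuous_onI continuous_intros)
  have mk: "(\<lambda>w. ?k w * ?u w) \<in> borel_measurable dA"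
    by (intro borel_measurable_dA) measurable
  have bnd: "AE w in dA. norm (?K (N + nat \<bar>k\<bar>) w * ?u w) \<le> ?c * norm (?u w)" for N
    unfolding norm_mult
    by (intro AE_I2 mult_right_mono kernel_partial_sum(2)[OF nz]) auto
  have dom: "integrable dA (\<lambda>w. ?c * norm (?u w))"
    using has_bochner_integral_dA_quasihomogeneous_disk[OF s, of k]
    by (intro integrable_mult_right integrable_norm) (simp add: has_bochner_integral_iff)
  have "(\<lambda>N. LINT w|dA. ?K (N + nat \<bar>k\<bar>) w * ?u w) \<longlonglongrightarrow> (LINT w|dA. ?k w * ?u w)"
    by (rule integral_dominated_convergence[OF mk mK dom lim bnd])
  moreover have "(LINT w|dA. ?K (N + nat \<bar>k\<bar>) w * ?u w) = ?val" for N
    by (rule has_bochner_integral_integral_eq[OF partial]) simp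
  ultimately have "(LINT w|dA. ?k w * ?u w) = ?val"
    using LIMSEQ_unique[OF _ tendsto_const] by simp
  moreover have "integrable dA (\<lambda>w. ?k w * ?u w)"
    by (rule integrable_dominated_convergence[OF mk mK dom lim bnd])
  ultimately show ?thesis by (simp add: has_bochner_integral_iff)
qed

definition toeplitz_weight :: "int \<Rightarrow> real \<Rightarrow> int \<Rightarrow> real" where
  "toeplitz_weight k m n = 2 * (of_int \<bar>n + k\<bar> + 1) / (m + of_int \<bar>n\<bar> + of_int \<bar>n + k\<bar> + 2)"

lemma toeplitz_weight_bound:
  assumes "m \<ge> -1"
  shows "norm (complex_of_real (toeplitz_weight k m n)) \<le> 2"
proof -
  have d: "0 < m + of_int \<bar>n\<bar> + of_int \<bar>n + k\<bar> + 2"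
    using assms by linarith
  have "2 * (of_int \<bar>n + k\<bar> + 1) \<le> 2 * (m + of_int \<bar>n\<bar> + of_int \<bar>n + k\<bar> + 2)"
    using assms by simp
  then have "toeplitz_weight k m n \<le> 2"
    using d by (simp add: toeplitz_weight_def pos_divide_le_eq)
  moreover have "0 \<le> toeplitz_weight k m n"
    unfolding toeplitz_weight_def by (intro divide_nonneg_pos d) auto
  ultimately show ?thesis by simp
qed

lemma Q_quasihomogeneous_partial_sum:
  assumes m: "m \<ge> -1" and z: "z \<in> unit_disk"
  shows "Q (\<lambda>w. quasihomogeneous k m w * lh2_fun (lh2_partial_sum h N) w) z
    = (\<Sum>n\<in>{- int N..int N}. lh2_coeff h n * of_real (toeplitz_weight k m n) * harmonic_monomial (n + k) z)"
proof -
  let ?k = "\<lambda>w. 1 / (1 - z * cnj w)\<^sup>2 + 1 / (1 - cnj z * w)\<^sup>2 - 1"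
  let ?q = "\<lambda>n. quasihomogeneous (n + k) (m + of_int \<bar>n\<bar>)"
  have "has_bochner_integral dA (\<lambda>w. \<Sum>n\<in>{- int N..int N}. lh2_coeff h n * (?k w * ?q n w))
      (\<Sum>n\<in>{- int N..int N}. lh2_coeff h n * (of_real (toeplitz_weight k m n) * harmonic_monomial (n + k) z))"
  proof (intro has_bochner_integral_sum has_bochner_integral_mult_right)
    fix n
    have "m + real_of_int \<bar>n\<bar> > -2" using m by linarith
    from has_bochner_integral_kernel_quasihomogeneous[OF z this, of "n + k"]
    show "has_bochner_integral dA (\<lambda>w. ?k w * ?q n w)
        (of_real (toeplitz_weight k m n) * harmonic_monomial (n + k) z)"
      by (simp only: toeplitz_weight_def)
  qed
  then have 1: "(LINT w|dA. (\<Sum>n\<in>{- int N..int N}. lh2_coeff h n * (?k w * ?q n w)))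
      = (\<Sum>n\<in>{- int N..int N}. lh2_coeff h n * (of_real (toeplitz_weight k m n) * harmonic_monomial (n + k) z))"
    by (rule has_bochner_integral_integral_eq)
  have "Q (\<lambda>w. quasihomogeneous k m w * lh2_fun (lh2_partial_sum h N) w) z
      = (LINT w|dA. (\<Sum>n\<in>{- int N..int N}. lh2_coeff h n * (?k w * ?q n w)))"
    unfolding Q_def
  proof (rule Bochner_Integration.integral_cong[OF refl])
    fix w assume "w \<in> space dA"
    then have w: "w \<in> unit_disk" by simp
    have q: "quasihomogeneous k m w * harmonic_monomial n w = ?q n w" for n
    proof (cases "w = 0")
      case False
      then show ?thesis
        by (simp add: quasihomogeneous_mult add.commute flip: quasihomogeneous_eq_harmonic_monomial)
    qed simp
    have "quasihomogeneous k m w * lh2_fun (lh2_partial_sum h N) w = (\<Sum>n\<in>{- int N..int N}. lh2_coeff h n * ?q n w)"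
      unfolding lh2_fun_partial_sum[OF w] harmonic_sum_def sum_distrib_left q[symmetric]
      by (simp add: mult_ac)
    then show "?k w * (quasihomogeneous k m w * lh2_fun (lh2_partial_sum h N) w)
        = (\<Sum>n\<in>{- int N..int N}. lh2_coeff h n * (?k w * ?q n w))"
      by (simp add: sum_distrib_left mult.left_commute)
  qed
  then show ?thesis unfolding 1 by (simp add: mult.assoc)
qed

text \<open>The definition of \<open>toeplitz\<close> by a definite description is met by exactly one bounded operator: the
weighted shift satisfies it, and two operators satisfying it agree on the dense set of harmonic
polynomials.\<close>

theorem lh2_coeff_toeplitz_quasihomogeneous:
  assumes m: "m \<ge> -1"
  shows "lh2_coeff (toeplitz (quasihomogeneous k m) h) n
    = of_real (toeplitz_weight k m (n - k)) * lh2_coeff h (n - k)"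
proof -
  let ?u = "quasihomogeneous k m"
  obtain T :: "lh2 \<Rightarrow>\<^sub>L lh2" where T: "\<And>h n. lh2_coeff (T h) n = of_real (toeplitz_weight k m (n - k)) * lh2_coeff h (n - k)"
    using ex_weighted_shift[where w = "\<lambda>n. of_real (toeplitz_weight k m n)", OF toeplitz_weight_bound[OF m]]
    by metis
  have T_Q: "lh2_fun (T h) z = Q (\<lambda>w. ?u w * lh2_fun h w) z"
    if h: "h \<in> harmonic_polynomials" and z: "z \<in> unit_disk" for h z
  proof -
    obtain N where N: "lh2_partial_sum h N = h" using h by (rule harmonic_polynomial_eq_partial_sum)
    let ?g = "\<Sum>n\<in>{- int N..int N}. scaleC_lh2 (lh2_coeff h n * of_real (toeplitz_weight k m n)) (lh2_monomial (n + k))"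
    have zero: "lh2_coeff h n = 0" if "\<not> \<bar>n\<bar> \<le> int N" for n
      using lh2_coeff_partial_sum[of h N n] that by (simp add: N)
    have "T h = ?g"
    proof (rule lh2_coeff_inject, rule ext)
      fix j
      have "lh2_coeff ?g j = (\<Sum>n\<in>{- int N..int N}. if n = j - k then lh2_coeff h n * of_real (toeplitz_weight k m n) else 0)"
        unfolding lh2_coeff_sum by (intro sum.cong) (auto simp: lh2_coeff_scaleC lh2_coeff_monomial)
      also have "\<dots> = lh2_coeff (T h) j"
        using zero[of "j - k"] by (subst sum.delta) (auto simp: T)
      finally show "lh2_coeff (T h) j = lh2_coeff ?g j" by simp
    qed
    then have "lh2_fun (T h) z
        = (\<Sum>n\<in>{- int N..int N}. lh2_coeff h n * of_real (toeplitz_weight k m n) * harmonic_monomial (n + k) z)"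
      using z by (simp add: lh2_fun_sum scaleC_lh2.rep_eq lh2_fun_monomial)
    also have "\<dots> = Q (\<lambda>w. ?u w * lh2_fun h w) z"
      using Q_quasihomogeneous_partial_sum[OF m z, where h = h and N = N] by (simp add: N)
    finally show ?thesis .
  qed
  have "toeplitz ?u = T"
    unfolding toeplitz_def
  proof (rule the_equality)
    show "\<forall>h\<in>harmonic_polynomials. \<forall>z\<in>unit_disk. lh2_fun (T h) z = Q (\<lambda>w. ?u w * lh2_fun h w) z"
      using T_Q by blast
    fix S :: "lh2 \<Rightarrow>\<^sub>L lh2"
    assume S: "\<forall>h\<in>harmonic_polynomials. \<forall>z\<in>unit_disk. lh2_fun (S h) z = Q (\<lambda>w. ?u w * lh2_fun h w) z"
    show "S = T"
    proof (rule blinfun_eq_on_harmonic_polynomials, rule lh2_eqI)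
      fix h z assume "h \<in> harmonic_polynomials" "z \<in> unit_disk"
      then show "lh2_fun (S h) z = lh2_fun (T h) z" using S T_Q by simp
    qed
  qed
  then show ?thesis by (simp add: T)
qed

section \<open>Finite rank of weighted shifts\<close>

text \<open>The range contains the monomial \<open>e\<^sub>n\<^sub>+\<^sub>k\<close> whenever \<open>w n \<noteq> 0\<close>, and the monomials are
linearly independent. Conversely the range lies in the set of elements whose coefficients vanish off
finitely many indices; this set is closed, as coefficients depend continuously on the element.\<close>

lemma finite_rank_weighted_shift_iff:
  assumes T: "\<And>h n. lh2_coeff (blinfun_apply T h) n = w (n - k) * lh2_coeff h (n - k)"
  shows "finite_rank T \<longleftrightarrow> finite {n. w n \<noteq> 0}"
proof
  assume "finite_rank T"
  then obtain B where B: "finite B" "closure (range T) \<subseteq> lh2.span B"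
    unfolding finite_rank_def by blast
  have inj: "inj lh2_monomial"
  proof (rule injI)
    fix i j assume "lh2_monomial i = lh2_monomial j"
    then have "lh2_coeff (lh2_monomial i) i = lh2_coeff (lh2_monomial j) i" by simp
    then show "i = j" by (simp add: lh2_coeff_monomial split: if_splits)
  qed
  have indep: "lh2.independent (range lh2_monomial)"
    unfolding lh2.independent_explicit_module
  proof (intro allI impI)
    fix t u v
    assume t: "finite t" "t \<subseteq> range lh2_monomial" and s: "(\<Sum>v\<in>t. scaleC_lh2 (u v) v) = 0" and v: "v \<in> t"
    obtain n where n: "v = lh2_monomial n" using t v by blast
    have "0 = lh2_coeff (\<Sum>v\<in>t. scaleC_lh2 (u v) v) n" by (simp add: s)
    also have "\<dots> = (\<Sum>x\<in>t. if x = v then u v else 0)"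
      unfolding lh2_coeff_sum
    proof (rule sum.cong[OF refl])
      fix x assume "x \<in> t"
      then obtain i where i: "x = lh2_monomial i" using t by blast
      show "lh2_coeff (scaleC_lh2 (u x) x) n = (if x = v then u v else 0)"
        using inj by (auto simp: i n lh2_coeff_scaleC lh2_coeff_monomial inj_eq)
    qed
    also have "\<dots> = u v" using t v by simp
    finally show "u v = 0" by simp
  qed
  let ?S = "(\<lambda>n. lh2_monomial (n + k)) ` {n. w n \<noteq> 0}"
  have "?S \<subseteq> lh2.span B"
  proof
    fix x assume "x \<in> ?S"
    then obtain n where n: "w n \<noteq> 0" "x = lh2_monomial (n + k)" by blast
    have "T (scaleC_lh2 (1 / w n) (lh2_monomial n)) = x"
      by (rule lh2_coeff_inject) (use n in \<open>auto simp: fun_eq_iff T lh2_coeff_scaleC lh2_coeff_monomial\<close>)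
    then have "x \<in> range T" by blast
    then show "x \<in> lh2.span B" using B(2) closure_subset by blast
  qed
  moreover have "lh2.independent ?S"
    by (rule lh2.independent_mono[OF indep]) auto
  ultimately have "finite ?S" using lh2.independent_span_bound[OF B(1)] by blast
  then show "finite {n. w n \<noteq> 0}"
    by (rule finite_imageD) (auto simp: inj_on_def inj_eq[OF inj])
next
  assume fin: "finite {n. w n \<noteq> 0}"
  let ?J = "(\<lambda>n. n + k) ` {n. w n \<noteq> 0}"
  let ?V = "{h. \<forall>j. j \<notin> ?J \<longrightarrow> lh2_coeff h j = 0}"
  have "closed ?V"
  proof -
    have "?V = (\<Inter>j\<in>- ?J. {h. lh2_coeff h j = 0})" by auto
    also have "closed \<dots>"
      by (intro closed_INT ballI closed_Collect_eq continuous_on_lh2_coeff continuous_on_const)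
    finally show ?thesis .
  qed
  moreover have "range T \<subseteq> ?V"
  proof (clarify)
    fix h j assume j: "j \<notin> ?J"
    have "w (j - k) = 0"
    proof (rule ccontr)
      assume "w (j - k) \<noteq> 0"
      then have "j - k + k \<in> ?J" by blast
      then show False using j by simp
    qed
    then show "lh2_coeff (T h) j = 0" by (simp add: T)
  qed
  ultimately have cl: "closure (range T) \<subseteq> ?V" by (rule closure_minimal[rotated])
  have "?V \<subseteq> lh2.span (lh2_monomial ` ?J)"
  proof
    fix h assume h: "h \<in> ?V"
    have "h = (\<Sum>j\<in>?J. scaleC_lh2 (lh2_coeff h j) (lh2_monomial j))"
    proof (rule lh2_coeff_inject, rule ext)
      fix i
      have "lh2_coeff (\<Sum>j\<in>?J. scaleC_lh2 (lh2_coeff h j) (lh2_monomial j)) i = (\<Sum>j\<in>?J. if j = i then lh2_coeff h j else 0)"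
        unfolding lh2_coeff_sum by (intro sum.cong) (auto simp: lh2_coeff_scaleC lh2_coeff_monomial)
      also have "\<dots> = lh2_coeff h i"
        using fin h by (subst sum.delta) auto
      finally show "lh2_coeff h i = lh2_coeff (\<Sum>j\<in>?J. scaleC_lh2 (lh2_coeff h j) (lh2_monomial j)) i" ..
    qed
    also have "\<dots> \<in> lh2.span (lh2_monomial ` ?J)"
      by (intro lh2.span_sum lh2.span_scale lh2.span_base) auto
    finally show "h \<in> lh2.span (lh2_monomial ` ?J)" .
  qed
  with cl show "finite_rank T"
    unfolding finite_rank_def using fin by (intro exI[of _ "lh2_monomial ` ?J"]) auto
qed

section \<open>The commutator\<close>

definition commutator_weight :: "int \<Rightarrow> real \<Rightarrow> int \<Rightarrow> real \<Rightarrow> int \<Rightarrow> real" where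
  "commutator_weight k1 m1 k2 m2 n =
     toeplitz_weight k1 m1 (n + k2) * toeplitz_weight k2 m2 n
     - toeplitz_weight k2 m2 (n + k1) * toeplitz_weight k1 m1 n"

lemma lh2_coeff_commutator:
  assumes "m1 \<ge> -1" "m2 \<ge> -1"
  shows "lh2_coeff (commutator (toeplitz (quasihomogeneous k1 m1)) (toeplitz (quasihomogeneous k2 m2)) h) n
    = of_real (commutator_weight k1 m1 k2 m2 (n - (k1 + k2))) * lh2_coeff h (n - (k1 + k2))"
  unfolding commutator_def blinfun.diff_left blinfun_apply_blinfun_compose o_apply lh2_coeff_diff
    lh2_coeff_toeplitz_quasihomogeneous[OF assms(1)] lh2_coeff_toeplitz_quasihomogeneous[OF assms(2)]
  by (simp add: commutator_weight_def algebra_simps)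

lemma toeplitz_weight_uminus: "toeplitz_weight k m (- n) = toeplitz_weight (- k) m n"
proof -
  have "\<bar>- n + k\<bar> = \<bar>n + - k\<bar>" by linarith
  then show ?thesis unfolding toeplitz_weight_def by (simp only: abs_minus_cancel)
qed

text \<open>Conjugation of functions exchanges \<open>e\<^sub>n\<close> and \<open>e\<^sub>-\<^sub>n\<close>, which reduces negative indices to positive
ones.\<close>

lemma commutator_weight_uminus:
  "commutator_weight k1 m1 k2 m2 (- n) = commutator_weight (- k1) m1 (- k2) m2 n"
  using toeplitz_weight_uminus[of k1 m1 "n - k2"] toeplitz_weight_uminus[of k2 m2 "n - k1"]
  by (simp add: commutator_weight_def toeplitz_weight_uminus)

text \<open>With \<open>x = n + 1\<close> the weight is a positive multiple of
\<open>(x + b) (m2 + 2 x + b + 2 a) (m1 + 2 x + a) - (x + a) (m1 + 2 x + a + 2 b) (m2 + 2 x + b)\<close>,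
whose terms of degree three and two cancel.\<close>

lemma commutator_weight_eq_0_iff:
  fixes k1 k2 n :: int and m1 m2 :: real
  defines "a \<equiv> real_of_int k1" and "b \<equiv> real_of_int k2"
  assumes m: "m1 \<ge> -1" "m2 \<ge> -1" and n: "n \<ge> \<bar>k1\<bar> + \<bar>k2\<bar>"
  shows "commutator_weight k1 m1 k2 m2 n = 0 \<longleftrightarrow>
    2 * (b * m1 - a * m2) * (of_int n + 1)
    + ((m1 + a) * (m2 + b) * (b - a) + 2 * a * b * ((m1 + a) - (m2 + b))) = 0"
proof -
  define x where "x = real_of_int n + 1"
  have ge: "0 \<le> n" "0 \<le> n + k1" "0 \<le> n + k2" "0 \<le> n + k1 + k2" "0 \<le> n + k2 + k1" using n by linarith+
  have ge': "1 \<le> x" "1 \<le> x + a" "1 \<le> x + b" "1 \<le> x + a + b"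
    using ge unfolding x_def a_def b_def by linarith+
  define d1 where "d1 = m1 + 2 * x + a + 2 * b"
  define d2 where "d2 = m2 + 2 * x + b"
  define d3 where "d3 = m2 + 2 * x + b + 2 * a"
  define d4 where "d4 = m1 + 2 * x + a"
  have d: "0 < d1" "0 < d2" "0 < d3" "0 < d4"
    using m ge' unfolding d1_def d2_def d3_def d4_def by linarith+
  have t1: "toeplitz_weight k1 m1 (n + k2) = 2 * (x + a + b) / d1"
    unfolding toeplitz_weight_def d1_def using ge by (simp add: x_def a_def b_def algebra_simps)
  have t2: "toeplitz_weight k2 m2 n = 2 * (x + b) / d2"
    unfolding toeplitz_weight_def d2_def using ge by (simp add: x_def a_def b_def algebra_simps)
  have t3: "toeplitz_weight k2 m2 (n + k1) = 2 * (x + a + b) / d3"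
    unfolding toeplitz_weight_def d3_def using ge by (simp add: x_def a_def b_def algebra_simps)
  have t4: "toeplitz_weight k1 m1 n = 2 * (x + a) / d4"
    unfolding toeplitz_weight_def d4_def using ge by (simp add: x_def a_def b_def algebra_simps)
  have "commutator_weight k1 m1 k2 m2 n
      = 4 * (x + a + b) * ((x + b) * d3 * d4 - (x + a) * d1 * d2) / (d1 * d2 * d3 * d4)"
    unfolding commutator_weight_def t1 t2 t3 t4 using d by (simp add: field_simps)
  then have "commutator_weight k1 m1 k2 m2 n = 0 \<longleftrightarrow> (x + b) * d3 * d4 - (x + a) * d1 * d2 = 0"
    using d ge' by simp
  also have "(x + b) * d3 * d4 - (x + a) * d1 * d2 = 2 * (b * m1 - a * m2) * x
      + ((m1 + a) * (m2 + b) * (b - a) + 2 * a * b * ((m1 + a) - (m2 + b)))"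
    unfolding d1_def d2_def d3_def d4_def by (simp add: algebra_simps power2_eq_square)
  finally show ?thesis unfolding x_def .
qed

text \<open>The first equation says \<open>(m1, m2) = t (a, b)\<close>. Substituting this turns the second expression into
\<open>a b (b - a) (t + 1) (t - 1)\<close>.\<close>

lemma commutator_weight_coefficients_eq_0_iff:
  fixes a b m1 m2 :: real
  assumes "a \<noteq> 0" "b \<noteq> 0"
  shows "b * m1 - a * m2 = 0 \<and> (m1 + a) * (m2 + b) * (b - a) + 2 * a * b * ((m1 + a) - (m2 + b)) = 0
    \<longleftrightarrow> (a = b \<and> m1 = m2) \<or> (a = m1 \<and> b = m2) \<or> (a = - m1 \<and> b = - m2)" (is "?L \<longleftrightarrow> ?R")
proof
  assume L: ?L
  define t where "t = m1 / a"
  have m1: "m1 = t * a" using assms by (simp add: t_def)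
  have m2: "m2 = t * b" using L assms by (simp add: t_def field_simps)
  have "0 = (m1 + a) * (m2 + b) * (b - a) + 2 * a * b * ((m1 + a) - (m2 + b))" using L by simp
  also have "\<dots> = a * b * (b - a) * ((t + 1) * (t - 1))"
    unfolding m1 m2 by (simp add: algebra_simps)
  finally have "b = a \<or> t = -1 \<or> t = 1" using assms by (auto simp: add_eq_0_iff)
  then show ?R using m1 m2 by auto
qed (auto simp: algebra_simps)

theorem corollary4p7:
  fixes k1 k2 :: int and m1 m2 :: real
  assumes "k1 * k2 \<noteq> 0" and "m1 \<ge> -1" and "m2 \<ge> -1"
  shows "finite_rank (commutator (toeplitz (quasihomogeneous k1 m1)) (toeplitz (quasihomogeneous k2 m2)))
     \<longleftrightarrow> (k1 = k2 \<and> m1 = m2)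
       \<or> (of_int k1 = m1 \<and> of_int k2 = m2)
       \<or> (of_int k1 = - m1 \<and> of_int k2 = - m2)"
proof -
  let ?w = "commutator_weight k1 m1 k2 m2"
  let ?a = "real_of_int k1" and ?b = "real_of_int k2"
  let ?l = "\<lambda>a b. b * m1 - a * m2"
  let ?c = "\<lambda>a b. (m1 + a) * (m2 + b) * (b - a) + 2 * a * b * ((m1 + a) - (m2 + b))"
  let ?R = "(k1 = k2 \<and> m1 = m2) \<or> (?a = m1 \<and> ?b = m2) \<or> (?a = - m1 \<and> ?b = - m2)"
  let ?K = "\<bar>k1\<bar> + \<bar>k2\<bar>"
  have k: "k1 \<noteq> 0" "k2 \<noteq> 0" using assms(1) by auto
  have "finite_rank (commutator (toeplitz (quasihomogeneous k1 m1)) (toeplitz (quasihomogeneous k2 m2)))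
      \<longleftrightarrow> finite {n. complex_of_real (?w n) \<noteq> 0}"
    by (rule finite_rank_weighted_shift_iff[OF lh2_coeff_commutator[OF assms(2,3)]])
  also have "\<dots> \<longleftrightarrow> finite {n. ?w n \<noteq> 0}" by simp
  also have "\<dots> \<longleftrightarrow> ?R"
  proof
    assume fin: "finite {n. ?w n \<noteq> 0}"
    \<comment> \<open>Two consecutive zeros in the range where the numerator is a linear polynomial in \<open>n\<close>.\<close>
    define n where "n = Max (insert ?K {n. ?w n \<noteq> 0}) + 1"
    have le: "j < n" if "j \<in> insert ?K {n. ?w n \<noteq> 0}" for j
      using fin that unfolding n_def by (metis Max_ge finite_insert zle_add1_eq_le)
    have "?w n = 0" "?w (n + 1) = 0" using le[of n] le[of "n + 1"] by auto
    moreover have "?K \<le> n" "?K \<le> n + 1" using le[of ?K] by auto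
    ultimately have "2 * ?l ?a ?b * (of_int n + 1) + ?c ?a ?b = 0"
      "2 * ?l ?a ?b * (of_int (n + 1) + 1) + ?c ?a ?b = 0"
      using commutator_weight_eq_0_iff[OF assms(2,3)] by blast+
    moreover have "s = 0 \<and> c = 0" if "s * (x + 1) + c = 0" "s * (x + 1 + 1) + c = 0" for s c x :: real
    proof -
      have "s * (x + 1 + 1) + c = (s * (x + 1) + c) + s" by (simp add: distrib_left)
      then have "s = 0" using that by linarith
      then show ?thesis using that by simp
    qed
    ultimately have "2 * ?l ?a ?b = 0 \<and> ?c ?a ?b = 0"
      by (metis of_int_add of_int_1)
    then have "?l ?a ?b = 0 \<and> ?c ?a ?b = 0" by simp
    then show ?R
      using commutator_weight_coefficients_eq_0_iff[of ?a ?b m1 m2] k by auto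
  next
    assume R: ?R
    have zero: "commutator_weight i m1 j m2 n = 0"
      if "?l (of_int i) (of_int j) = 0 \<and> ?c (of_int i) (of_int j) = 0" "n \<ge> \<bar>i\<bar> + \<bar>j\<bar>" for i j n
      using commutator_weight_eq_0_iff[OF assms(2,3) that(2)] that(1) by simp
    have "?l ?a ?b = 0 \<and> ?c ?a ?b = 0"
      using R k commutator_weight_coefficients_eq_0_iff[of ?a ?b m1 m2] by auto
    then have pos: "?w n = 0" if "n \<ge> ?K" for n using zero that by blast
    have "?l (- ?a) (- ?b) = 0 \<and> ?c (- ?a) (- ?b) = 0"
      using R k commutator_weight_coefficients_eq_0_iff[of "- ?a" "- ?b" m1 m2] by auto
    then have "commutator_weight (- k1) m1 (- k2) m2 n = 0" if "n \<ge> ?K" for n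
      using zero[where i = "- k1" and j = "- k2"] that by (simp only: of_int_minus abs_minus_cancel)
    then have neg: "?w (- n) = 0" if "n \<ge> ?K" for n
      using that by (simp add: commutator_weight_uminus)
    have "{n. ?w n \<noteq> 0} \<subseteq> {- ?K..?K}"
    proof
      fix n assume "n \<in> {n. ?w n \<noteq> 0}"
      then have "\<not> ?K \<le> n" "\<not> ?K \<le> - n" using pos[of n] neg[of "- n"] by auto
      then show "n \<in> {- ?K..?K}" by simp
    qed
    then show "finite {n. ?w n \<noteq> 0}" by (rule finite_subset) simp
  qed
  finally show ?thesis .
qed

end
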